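(* Let $2<p<8$ and $M_0>0$. The minimization problem $$\min H(u)\quad\text{subject to}\quad M(u)=M_0$$ over real-valued functions $u$ on $\mathbb{R}$ admits a minimizer, and the minimizers are, up to translation and sign, compactons $\Phi_{B,c}$: every minimizer is of the form $\pm\Phi_{B,c}(\cdot-a)$ for some $a\in\mathbb{R}$ and some $(B,c)$ with either $B>0$, $c\in\mathbb{R}$, or $B=0$, $c>0$. If $p=4$, the minimizer is (up to translation and sign) $\Phi_{0,c}$ with $c=\dfrac{M_0}{\sqrt2\,\pi}$.
   Context: $H(u)=\frac12\int_{\mathbb{R}}|u\partial_xu|^2\,dx-\frac1p\int_{\mathbb{R}}|u|^p\,dx$ and $M(u)=\int_{\mathbb{R}}|u|^2\,dx$. The admissible functions are the continuous real-valued $u\in L^2(\mathbb{R})$ with $u^2\in H^1(\mathbb{R})$, and $u\partial_xu$ is understood as $\frac12\partial_x(u^2)$. For $B>0$, $c\in\mathbb{R}$, or $B=0$, $c>0$, the compacton $\Phi_{B,c}$ is the (unique) continuous, nonnegative, even function on $\mathbb{R}$ for which there is $x_{B,c}>0$ such that $\Phi_{B,c}=0$ outside $(-x_{B,c},x_{B,c})$, $\Phi_{B,c}$ is positive and smooth on $(-x_{B,c},x_{B,c})$, decreasing on $(0,x_{B,c})$, and $\phi=\Phi_{B,c}$ satisfies on $(-x_{B,c},x_{B,c})$ both $-c\phi+\phi(\phi\phi')'+\phi^{p-1}=0$ and $-\frac c2\phi^2+\frac12(\phi\phi')^2+\frac1p\phi^p=B$. For $p=4$, $\Phi_{0,c}(x)=\sqrt{2c}\cos(x/\sqrt2)$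 for $|x|\le\pi/\sqrt2$ and $0$ otherwise. *)

theory Defs
  imports "HOL-Analysis.Analysis"
begin

(* On an open set S the n-th derivative at a point of S only depends on f near that point,
   so the values of f and of deriv outside S are irrelevant. *)
definition smooth_on_open :: "real set \<Rightarrow> (real \<Rightarrow> real) \<Rightarrow> bool" where
  "smooth_on_open S f \<longleftrightarrow>
     open S \<and> (\<forall>n. \<forall>x\<in>S. ((deriv ^^ n) f) differentiable (at x))"

definition test_function :: "(real \<Rightarrow> real) \<Rightarrow> bool" where
  "test_function \<eta> \<longleftrightarrow> smooth_on_open UNIV \<eta> \<and> compact (closure {x. \<eta> x \<noteq> 0})"

definition locally_integrable :: "(real \<Rightarrow> real) \<Rightarrow> bool" where
  "locally_integrable f \<longleftrightarrow> (\<forall>a b. set_integrable lborel {a..b} f)"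

definition has_weak_deriv :: "(real \<Rightarrow> real) \<Rightarrow> (real \<Rightarrow> real) \<Rightarrow> bool" where
  "has_weak_deriv f g \<longleftrightarrow> locally_integrable f \<and> locally_integrable g \<and>
     (\<forall>\<eta>. test_function \<eta> \<longrightarrow>
        (LINT x|lborel. f x * deriv \<eta> x) = - (LINT x|lborel. g x * \<eta> x))"

(* A weak derivative is unique only up to null sets; the choice made here is immaterial
   wherever weak_deriv f occurs under an integral. *)
definition weak_deriv :: "(real \<Rightarrow> real) \<Rightarrow> real \<Rightarrow> real" where
  "weak_deriv f = (SOME g. has_weak_deriv f g)"

definition in_L2 :: "(real \<Rightarrow> real) \<Rightarrow> bool" where
  "in_L2 f \<longleftrightarrow> f \<in> borel_measurable lborel \<and> integrable lborel (\<lambda>x. (f x)\<^sup>2)"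

definition in_H1 :: "(real \<Rightarrow> real) \<Rightarrow> bool" where
  "in_H1 f \<longleftrightarrow> in_L2 f \<and> (\<exists>g. has_weak_deriv f g \<and> in_L2 g)"

definition admissible :: "(real \<Rightarrow> real) \<Rightarrow> bool" where
  "admissible u \<longleftrightarrow> continuous_on UNIV u \<and> in_L2 u \<and> in_H1 (\<lambda>x. (u x)\<^sup>2)"

(* u u_x, understood as half the weak derivative of u^2 *)
definition u_ux :: "(real \<Rightarrow> real) \<Rightarrow> real \<Rightarrow> real" where
  "u_ux u x = 1/2 * weak_deriv (\<lambda>y. (u y)\<^sup>2) x"

definition hamiltonian :: "real \<Rightarrow> (real \<Rightarrow> real) \<Rightarrow> real" where
  "hamiltonian p u =
     1/2 * (LINT x|lborel. \<bar>u_ux u x\<bar>\<^sup>2) - 1/p * (LINT x|lborel. \<bar>u x\<bar> powr p)"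

definition mass :: "(real \<Rightarrow> real) \<Rightarrow> real" where
  "mass u = (LINT x|lborel. \<bar>u x\<bar>\<^sup>2)"

definition is_minimizer :: "real \<Rightarrow> real \<Rightarrow> (real \<Rightarrow> real) \<Rightarrow> bool" where
  "is_minimizer p M\<^sub>0 u \<longleftrightarrow> admissible u \<and> mass u = M\<^sub>0 \<and>
     (\<forall>v. admissible v \<and> mass v = M\<^sub>0 \<longrightarrow> hamiltonian p u \<le> hamiltonian p v)"

definition is_compacton :: "real \<Rightarrow> real \<Rightarrow> real \<Rightarrow> (real \<Rightarrow> real) \<Rightarrow> bool" where
  "is_compacton p B c \<phi> \<longleftrightarrow>
     continuous_on UNIV \<phi> \<and> (\<forall>x. \<phi> x \<ge> 0) \<and> (\<forall>x. \<phi> (- x) = \<phi> x) \<and>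
     (\<exists>r>0.
        (\<forall>x. x \<notin> {-r<..<r} \<longrightarrow> \<phi> x = 0) \<and>
        (\<forall>x\<in>{-r<..<r}. \<phi> x > 0) \<and>
        smooth_on_open {-r<..<r} \<phi> \<and>
        strict_antimono_on {0<..<r} \<phi> \<and>
        (\<forall>x\<in>{-r<..<r}.
           - c * \<phi> x + \<phi> x * deriv (\<lambda>y. \<phi> y * deriv \<phi> y) x + \<phi> x powr (p - 1) = 0 \<and>
           - (c / 2) * (\<phi> x)\<^sup>2 + 1/2 * (\<phi> x * deriv \<phi> x)\<^sup>2 + 1/p * \<phi> x powr p = B))"

definition compacton :: "real \<Rightarrow> real \<Rightarrow> real \<Rightarrow> real \<Rightarrow> real" where
  "compacton p B c = (THE \<phi>. is_compacton p B c \<phi>)"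

definition compacton_params :: "real \<Rightarrow> real \<Rightarrow> bool" where
  "compacton_params B c \<longleftrightarrow> B > 0 \<or> (B = 0 \<and> c > 0)"

definition translate_up_to_sign :: "(real \<Rightarrow> real) \<Rightarrow> (real \<Rightarrow> real) \<Rightarrow> bool" where
  "translate_up_to_sign u \<phi> \<longleftrightarrow>
     (\<exists>a. u = (\<lambda>x. \<phi> (x - a)) \<or> u = (\<lambda>x. - \<phi> (x - a)))"

end

theory Submission
  imports Defs "HOL-Computational_Algebra.Polynomial"
begin

text \<open>
  For \<^term>\<open>w = u\<^sup>2\<close> the energy is \<open>\<integral> w'\<^sup>2/8 - w\<^sup>q/p\<close> with \<open>q = p/2\<close> and the mass is \<open>\<integral> w\<close>.  Let
  \<open>m = max w\<close>, attained at \<open>x0\<close>, and \<open>G s = (m\<^sup>q\<^sup>-\<^sup>1 s - s\<^sup>q)/p\<close>, which is nonnegative on \<open>[0, m]\<close>.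
  Completing the square as in Bogomolny's trick gives, with \<open>\<sigma> = 1\<close> to the left of \<open>x0\<close> and
  \<open>\<sigma> = -1\<close> to the right, the exact identity
  \<open>H = \<integral> (w'/\<surd>8 - \<sigma> \<surd>(G w))\<^sup>2 + 2 K m\<^bsup>1+p/4\<^esup> - m\<^sup>q\<^sup>-\<^sup>1 M/p\<close>.
  For \<open>p < 8\<close> the last two terms have a unique minimum in \<open>m\<close>; by a Pohozaev identity the compacton
  with \<open>B = 0\<close> and this maximum has exactly the prescribed mass, and its square term vanishes, so it is a
  minimizer.  Conversely, a minimizer has this maximum and satisfies \<open>w' = \<sigma> \<surd>(8 G w)\<close>.  Such a \<open>w\<close>
  can only differ from the squared compacton by a plateau at height \<open>m\<close>, which the mass excludes.
\<close>

section \<open>Smooth cut-off functions\<close>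

text \<open>The linear part of G has the slope m^(q-1) because G then vanishes at 0 and at m: it is
  the level B = 0 of the first integral, written for w with peak m, and its linear part integrates
  to a multiple of the prescribed mass. The sign \<sigma> changes at the peak because the cross term
  is, on each side, an exact derivative whose integral depends on m alone. The condition p < 8 says
  that the exponent 1 + p/4 exceeds p/2 - 1. Two obstacles shape the development. An admissible u
  only has a weak derivative of u^2, and \<open>weak_deriv\<close> picks one by choice; hence the
  increment formula, the chain rule along functions that are merely integrals, and almost everywhere
  uniqueness. Moreover G has simple zeros at 0 and m, so the right-hand side of w' = \<sigma>
  \<surd>(8 G w) behaves like a square root there: solutions reach 0 in finite time, which gives the
  compact support, and may rest at m, so uniqueness fails at the peak. A change of variable removes
  both singularities where the solution really moves, and the resting time is treated as a
  delay.\<close>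

lemma smooth_on_open_family:
  assumes S: "open S"
    and D: "\<And>h. h \<in> D \<Longrightarrow> \<exists>h'\<in>D. \<forall>x\<in>S. (h has_real_derivative h' x) (at x)"
    and f: "f \<in> D"
  shows "smooth_on_open S f"
proof -
  \<comment> \<open>Nothing is known about the iterated \<open>deriv\<close> outside
    \<open>S\<close>, so the induction only tracks agreement with a member of \<open>D\<close> on
    \<open>S\<close>; openness of \<open>S\<close> turns agreement into equality of
    derivatives.\<close>
  have E: "\<exists>h\<in>D. \<forall>x\<in>S. (deriv ^^ n) f x = h x" for n
  proof (induction n)
    case 0
    then show ?case using f by auto
  next
    case (Suc n)
    then obtain h where h: "h \<in> D" "\<forall>x\<in>S. (deriv ^^ n) f x = h x" by auto
    from D[OF h(1)] obtain h' where h': "h' \<in> D" "\<forall>x\<in>S. (h has_real_derivative h' x) (at x)" by auto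
    have "(deriv ^^ Suc n) f x = h' x" if "x \<in> S" for x
    proof -
      have "((deriv ^^ n) f has_real_derivative h' x) (at x)"
        by (rule has_field_derivative_transform_within_open[where S=S and f=h]) (use h' h S that in auto)
      then show ?thesis by (simp add: DERIV_imp_deriv)
    qed
    with h' show ?case by auto
  qed
  have "((deriv ^^ n) f) differentiable (at x)" if x: "x \<in> S" for n x
  proof -
    from E[of n] obtain h where h: "h \<in> D" "\<forall>x\<in>S. (deriv ^^ n) f x = h x" by auto
    from D[OF h(1)] obtain h' where h': "h' \<in> D" "\<forall>x\<in>S. (h has_real_derivative h' x) (at x)" by auto
    have "((deriv ^^ n) f has_real_derivative h' x) (at x)"
      by (rule has_field_derivative_transform_within_open[where S=S and f=h]) (use h' h S x in auto)
    then show ?thesis using real_differentiable_def by blast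
  qed
  then show ?thesis using S by (auto simp: smooth_on_open_def)
qed

text \<open>By the Leibniz rule this algebra is closed under differentiation as soon as it contains
  the derivatives of the generators. Smoothness then follows without formulas for higher
  derivatives.\<close>

inductive_set fun_algebra :: "(real \<Rightarrow> real) set \<Rightarrow> (real \<Rightarrow> real) set" for B where
  base: "b \<in> B \<Longrightarrow> b \<in> fun_algebra B"
| const: "(\<lambda>x. c) \<in> fun_algebra B"
| add: "f \<in> fun_algebra B \<Longrightarrow> g \<in> fun_algebra B \<Longrightarrow> (\<lambda>x. f x + g x) \<in> fun_algebra B"
| mult: "f \<in> fun_algebra B \<Longrightarrow> g \<in> fun_algebra B \<Longrightarrow> (\<lambda>x. f x * g x) \<in> fun_algebra B"

lemma fun_algebra_smooth:
  assumes S: "open S"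
    and B: "\<And>h. h \<in> B \<Longrightarrow> \<exists>h'\<in>fun_algebra B. \<forall>x\<in>S. (h has_real_derivative h' x) (at x)"
    and f: "f \<in> fun_algebra B"
  shows "smooth_on_open S f"
proof (rule smooth_on_open_family[OF S _ f])
  fix h assume "h \<in> fun_algebra B"
  then show "\<exists>h'\<in>fun_algebra B. \<forall>x\<in>S. (h has_real_derivative h' x) (at x)"
  proof induction
    case (base b)
    then show ?case by (rule B)
  next
    case (const c)
    then show ?case by (intro bexI[of _ "\<lambda>x. 0"] fun_algebra.const) auto
  next
    case (add f g)
    then obtain f' g' where "f' \<in> fun_algebra B" "g' \<in> fun_algebra B"
      "\<forall>x\<in>S. (f has_real_derivative f' x) (at x)" "\<forall>x\<in>S. (g has_real_derivative g' x) (at x)" by blast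
    then show ?case
      by (intro bexI[of _ "\<lambda>x. f' x + g' x"] fun_algebra.add) (auto intro!: derivative_intros)
  next
    case (mult f g)
    then obtain f' g' where *: "f' \<in> fun_algebra B" "g' \<in> fun_algebra B"
      "\<forall>x\<in>S. (f has_real_derivative f' x) (at x)" "\<forall>x\<in>S. (g has_real_derivative g' x) (at x)" by blast
    then show ?case using mult.hyps
      by (intro bexI[of _ "\<lambda>x. f' x * g x + g' x * f x"] fun_algebra.add fun_algebra.mult) (auto intro!: DERIV_mult)
  qed
qed

text \<open>The classical smooth function that is flat at 0, with a polynomial in 1/x as a factor:
  all its derivatives have this form, since differentiation replaces \<open>P\<close> by X^2 (P -
  P').\<close>

definition flat_exp :: "real poly \<Rightarrow> real \<Rightarrow> real" where
  "flat_exp P x = (if x > 0 then poly P (1/x) * exp (- (1/x)) else 0)"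

lemma poly_exp_tendsto_0: "((\<lambda>r::real. poly P r * exp (- r)) \<longlongrightarrow> 0) at_top"
proof -
  have "((\<lambda>r::real. \<Sum>i\<le>degree P. coeff P i * (r ^ i / exp r)) \<longlongrightarrow> (\<Sum>i\<le>degree P. coeff P i * 0)) at_top"
    by (intro tendsto_intros tendsto_power_div_exp_0)
  moreover have "(\<lambda>r::real. \<Sum>i\<le>degree P. coeff P i * (r ^ i / exp r)) = (\<lambda>r. poly P r * exp (- r))"
    by (auto simp: poly_altdef sum_distrib_right exp_minus divide_inverse mult.assoc fun_eq_iff)
  ultimately show ?thesis by simp
qed

lemma flat_exp_tendsto_0: "((\<lambda>x. flat_exp P x) \<longlongrightarrow> 0) (at 0)"
proof -
  have R: "(flat_exp P \<longlongrightarrow> 0) (at_right 0)"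
  proof -
    have "((\<lambda>x::real. poly P (inverse x) * exp (- inverse x)) \<longlongrightarrow> 0) (at_right 0)"
      by (rule filterlim_compose[OF poly_exp_tendsto_0 filterlim_inverse_at_top_right])
    then show ?thesis
      by (rule Lim_transform_eventually)
         (auto simp: eventually_at_filter flat_exp_def field_simps inverse_eq_divide)
  qed
  have L: "(flat_exp P \<longlongrightarrow> 0) (at_left 0)"
    by (rule Lim_transform_eventually[OF tendsto_const]) (auto simp: eventually_at_filter flat_exp_def)
  from L R show ?thesis by (simp add: filterlim_at_split)
qed

lemma DERIV_flat_exp:
  "(flat_exp P has_real_derivative flat_exp ([:0,0,1:] * (P - pderiv P)) x) (at x)"
proof -
  consider "x > 0" | "x < 0" | "x = 0" by linarith
  then show ?thesis
  proof cases
    case 1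
    have D: "((\<lambda>x. poly P (1/x) * exp (- (1/x))) has_real_derivative
        poly P (1/x) * (exp (- (1/x)) * (1 / x^2)) + poly (pderiv P) (1/x) * (- 1/x^2) * exp (- (1/x))) (at x)"
      using 1 by (auto intro!: derivative_eq_intros DERIV_chain2[OF poly_DERIV] simp: power2_eq_square field_simps)
    show ?thesis
      by (rule has_field_derivative_transform_within_open[where S="{0<..}", OF DERIV_cong[OF D]])
         (use 1 in \<open>auto simp: flat_exp_def power2_eq_square field_simps\<close>)
  next
    case 2
    show ?thesis
      by (rule has_field_derivative_transform_within_open[where S="{..<0}" and f="\<lambda>x. 0"])
         (use 2 in \<open>auto simp: flat_exp_def intro!: derivative_eq_intros\<close>)
  next
    case 3
    \<comment> \<open>At 0 the difference quotient of \<open>flat_exp P\<close> is the flat function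
      with polynomial X P, and so tends to 0.\<close>
    have "((\<lambda>h. flat_exp ([:0,1:] * P) h) \<longlongrightarrow> 0) (at 0)" by (rule flat_exp_tendsto_0)
    then have "((\<lambda>h. (flat_exp P (0+h) - flat_exp P 0) / h) \<longlongrightarrow> 0) (at 0)"
      by (rule Lim_transform_eventually) (auto simp: flat_exp_def eventually_at_filter)
    then show ?thesis using 3 by (simp add: DERIV_def flat_exp_def)
  qed
qed

lemma DERIV_flat_exp_affine:
  "((\<lambda>x. flat_exp P (\<alpha> * x + \<beta>)) has_real_derivative
     \<alpha> * flat_exp ([:0,0,1:] * (P - pderiv P)) (\<alpha> * x + \<beta>)) (at x)"
proof -
  have "((\<lambda>x. \<alpha> * x + \<beta>) has_real_derivative \<alpha>) (at x)" by (auto intro!: derivative_eq_intros)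
  from DERIV_chain2[OF DERIV_flat_exp this, of P] show ?thesis by (subst mult.commute)
qed

definition bump :: "real \<Rightarrow> real" where
  "bump x = flat_exp 1 x * flat_exp 1 (1 - x)"

text \<open>A smooth step between 0 and 1. Its height \<open>bump_mass\<close> is not normalized;
  the factor cancels at the end of \<open>weak_deriv_continuous_increment\<close>.\<close>

definition bump_int :: "real \<Rightarrow> real" where
  "bump_int x = (LBINT y=0..x. bump y)"

lemma bump_nonneg: "bump x \<ge> 0" and bump_pos: "0 < x \<Longrightarrow> x < 1 \<Longrightarrow> bump x > 0"
  and bump_eq_0: "x \<le> 0 \<or> x \<ge> 1 \<Longrightarrow> bump x = 0"
  by (auto simp: bump_def flat_exp_def)

lemma continuous_bump [continuous_intros]: "continuous_on S f \<Longrightarrow> continuous_on S (\<lambda>x. bump (f x))"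
proof -
  have c: "continuous_on T (flat_exp P)" for P T
    by (rule DERIV_continuous_on) (rule has_field_derivative_at_within[OF DERIV_flat_exp])
  have "continuous_on UNIV bump" unfolding bump_def
    by (intro continuous_intros continuous_on_compose2[OF c[of UNIV]]) auto
  then show "continuous_on S f \<Longrightarrow> continuous_on S (\<lambda>x. bump (f x))"
    by (rule continuous_on_compose2) auto
qed

lemma DERIV_bump_int: "(bump_int has_real_derivative bump x) (at x)"
proof -
  let ?a = "min x 0 - 1" and ?b = "max x 0 + 1"
  have "((\<lambda>u. LBINT y=0..u. bump y) has_vector_derivative (bump x)) (at x within {?a..?b})"
    using interval_integral_FTC2[of ?a 0 ?b bump x] by (auto simp: zero_ereal_def continuous_bump)
  then have "((\<lambda>u. LBINT y=0..u. bump y) has_vector_derivative (bump x)) (at x)"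
    by (subst (asm) at_within_interior) (auto simp: interior_atLeastAtMost_real)
  then show ?thesis
    by (simp add: has_real_derivative_iff_has_vector_derivative bump_int_def[abs_def])
qed

lemma bump_int_0: "bump_int 0 = 0"
  by (simp add: bump_int_def zero_ereal_def)

lemma bump_int_mono: "x \<le> y \<Longrightarrow> bump_int x \<le> bump_int y"
  by (rule DERIV_nonneg_imp_nondecreasing) (use DERIV_bump_int bump_nonneg in blast)+

lemma bump_int_const: 
  assumes "x \<le> y" "\<And>t. x < t \<Longrightarrow> t < y \<Longrightarrow> bump t = 0"
  shows "bump_int x = bump_int y"
proof (cases "x = y")
  case False
  obtain z where "x < z" "z < y" "bump_int y - bump_int x = (y - x) * bump z"
    using MVT2[of x y bump_int bump] False assms(1) DERIV_bump_int by auto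
  then show ?thesis using assms(2)[of z] by auto
qed auto

lemma bump_int_le_0: "x \<le> 0 \<Longrightarrow> bump_int x = 0"
  using bump_int_const[of x 0] bump_int_0 bump_eq_0 by force

definition bump_mass :: real where "bump_mass = bump_int 1"

lemma bump_int_ge_1: "x \<ge> 1 \<Longrightarrow> bump_int x = bump_mass"
  using bump_int_const[of 1 x] bump_eq_0 unfolding bump_mass_def by fastforce

lemma bump_mass_pos: "bump_mass > 0"
proof -
  obtain z where "0 < z" "z < 1" "bump_int 1 - bump_int 0 = (1 - 0) * bump z"
    using MVT2[of 0 1 bump_int bump] DERIV_bump_int by auto
  then show ?thesis using bump_pos[of z] bump_int_0 by (auto simp: bump_mass_def)
qed

text \<open>For a \<le> b and large N a multiple of a smoothed indicator of (a, b]: its derivative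
  is a positive peak just to the right of a and a negative one just to the right of b, each of width
  1/N.\<close>

definition cutoff :: "real \<Rightarrow> real \<Rightarrow> real \<Rightarrow> real \<Rightarrow> real" where
  "cutoff a b N x = bump_int (N * (x - a)) - bump_int (N * (x - b))"

lemma DERIV_cutoff:
  "(cutoff a b N has_real_derivative N * bump (N * (x - a)) - N * bump (N * (x - b))) (at x)"
  unfolding cutoff_def[abs_def]
  by (auto intro!: derivative_eq_intros DERIV_chain2[OF DERIV_bump_int])

lemma cutoff_test_function:
  assumes "N > 0" "a \<le> b"
  shows "test_function (cutoff a b N)"
proof -
  \<comment> \<open>The cutoff is an antiderivative and not a polynomial expression in flat
    exponentials, so it is adjoined as a generator of its own.\<close>
  define B where "B = insert (cutoff a b N) {h. \<exists>P \<alpha> \<beta>. h = (\<lambda>x. flat_exp P (\<alpha> * x + \<beta>))}"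
  have fB: "(\<lambda>x. flat_exp P (\<alpha> * x + \<beta>)) \<in> fun_algebra B" for P \<alpha> \<beta>
    by (rule fun_algebra.base) (auto simp: B_def)
  have bB: "(\<lambda>x. bump (N * (x - a))) \<in> fun_algebra B" for a
    using fun_algebra.mult[OF fB[of 1 N "-N*a"] fB[of 1 "-N" "1+N*a"]]
    by (simp add: bump_def algebra_simps)
  have "smooth_on_open UNIV (cutoff a b N)"
  proof (rule fun_algebra_smooth[where B=B])
    fix h assume "h \<in> B"
    then consider "h = cutoff a b N" | P \<alpha> \<beta> where "h = (\<lambda>x. flat_exp P (\<alpha> * x + \<beta>))"
      by (auto simp: B_def)
    then show "\<exists>h'\<in>fun_algebra B. \<forall>x\<in>UNIV. (h has_real_derivative h' x) (at x)"
    proof cases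
      case 1
      let ?h' = "\<lambda>x. N * bump (N * (x - a)) + (-N) * bump (N * (x - b))"
      have mem: "?h' \<in> fun_algebra B"
        by (intro fun_algebra.add fun_algebra.mult fun_algebra.const bB)
      have der: "\<forall>x\<in>UNIV. (h has_real_derivative ?h' x) (at x)"
        using DERIV_cutoff[of a b N] 1 by auto
      show ?thesis by (rule bexI[of _ "?h'"]) (fact der mem)+
    next
      case 2
      let ?h' = "\<lambda>x. \<alpha> * flat_exp ([:0,0,1:] * (P - pderiv P)) (\<alpha> * x + \<beta>)"
      have mem: "?h' \<in> fun_algebra B"
        by (rule fun_algebra.mult[OF fun_algebra.const, OF fB])
      have der: "\<forall>x\<in>UNIV. (h has_real_derivative ?h' x) (at x)"
        unfolding 2 by (intro ballI DERIV_flat_exp_affine)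
      show ?thesis by (rule bexI[of _ "?h'"]) (fact der mem)+
    qed
  next
    show "cutoff a b N \<in> fun_algebra B" by (rule fun_algebra.base) (simp add: B_def)
  qed simp
  moreover have "compact (closure {x. cutoff a b N x \<noteq> 0})"
  proof (rule compact_closure[THEN iffD2], rule bounded_subset[OF bounded_closed_interval[of a "b + 1/N"]])
    show "{x. cutoff a b N x \<noteq> 0} \<subseteq> {a..b + 1/N}"
    proof (rule subsetI, rule ccontr)
      fix x assume x: "x \<in> {x. cutoff a b N x \<noteq> 0}" "x \<notin> {a..b + 1/N}"
      from x(2) consider "x < a" | "x > b + 1/N" by (auto simp: not_le)
      then show False
      proof cases
        case 1
        then have "N * (x-a) \<le> 0" "N * (x - b) \<le> 0" using assms by (auto simp: mult_le_0_iff)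
        then show False using x(1) by (simp add: cutoff_def bump_int_le_0)
      next
        case 2
        then have "N * (1/N) \<le> N * (x-b)" using assms by (intro mult_left_mono) auto
        then have "N * (x-b) \<ge> 1" using assms by simp
        moreover have "N * (x - a) \<ge> N * (x-b)" using assms by (intro mult_left_mono) auto
        ultimately show False using x(1) by (simp add: cutoff_def bump_int_ge_1)
      qed
    qed
  qed
  ultimately show ?thesis by (simp add: test_function_def)
qed

section \<open>Weak derivatives of continuous functions\<close>

lemma bump_neq_0: "bump x \<noteq> 0 \<Longrightarrow> 0 < x \<and> x < 1"
  using bump_eq_0[of x] by linarith

lemma continuous_on_Icc_abs_bounded:
  fixes f :: "real \<Rightarrow> real"
  assumes "continuous_on {a..b} f"
  obtains B where "\<And>x. x \<in> {a..b} \<Longrightarrow> \<bar>f x\<bar> \<le> B"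
proof -
  have "bounded (f ` {a..b})"
    using assms by (intro compact_imp_bounded compact_continuous_image) auto
  then obtain B where "\<forall>y\<in>f ` {a..b}. norm y \<le> B" unfolding bounded_iff by blast
  then show ?thesis using that[of B] by auto
qed

lemma set_integral_split_real:
  fixes g :: "real \<Rightarrow> real"
  assumes "set_integrable lborel {a..b} g" "a \<le> x" "x \<le> b"
  shows "(LINT t:{a..b}|lborel. g t) = (LINT t:{a..x}|lborel. g t) + (LINT t:{x..b}|lborel. g t)"
proof -
  have 1: "set_integrable lborel {a..x} g" "set_integrable lborel {x..b} g"
    using assms by (auto intro: set_integrable_subset)
  then show ?thesis
    using assms 
    by (simp add: set_borel_integral_eq_integral Henstock_Kurzweil_Integration.integral_combine)
qed

lemma locally_integrable_measurable:
  assumes "locally_integrable g"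
  shows "g \<in> borel_measurable borel"
proof -
  have meas: "(\<lambda>x. indicator {- real n..real n} x *\<^sub>R g x) \<in> borel_measurable borel" for n
    using assms[unfolded locally_integrable_def set_integrable_def, rule_format,
        THEN borel_measurable_integrable] by simp
  have lim: "(\<lambda>n. indicator {- real n..real n} x *\<^sub>R g x) \<longlonglongrightarrow> g x" for x
  proof (rule tendsto_eventually)
    obtain N :: nat where "\<bar>x\<bar> \<le> N" using real_arch_simple by blast
    then show "\<forall>\<^sub>F n in sequentially. indicator {- real n..real n} x *\<^sub>R g x = g x"
      by (intro eventually_sequentiallyI[of N]) (auto simp: indicator_def)
  qed
  show ?thesis by (rule borel_measurable_LIMSEQ_real[OF lim meas])
qed

text \<open>The weak derivative is tested against \<open>cutoff a b N\<close>. As N grows, the two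
  peaks of the derivative of the cutoff act on the continuous f as point masses at a and b, while
  the cutoff itself tends to a multiple of an indicator.\<close>

lemma weak_deriv_continuous_increment:
  assumes f: "continuous_on UNIV f" and W: "has_weak_deriv f g" and ab: "a \<le> b"
  shows "f b - f a = (LINT t:{a..b}|lborel. g t)"
proof -
  define \<kappa> where "\<kappa> = bump_mass"
  have \<kappa>: "\<kappa> > 0" by (simp add: \<kappa>_def bump_mass_pos)
  \<comment> \<open>\<open>Suc n\<close> keeps the widths 1/N at most 1, so one bound of f on
    [c, c + 1] and one dominating function on [a, b + 1] serve all n.\<close>
  let ?N = "\<lambda>n. real (Suc n)"
  have intbump: "has_bochner_integral lborel bump \<kappa>"
  proof -
    have "has_bochner_integral lborel (\<lambda>x. indicator {0..1} x *\<^sub>R bump x) (bump_int 1 - bump_int 0)"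
      by (rule has_bochner_integral_FTC_Icc)
        (auto intro: continuous_bump has_field_derivative_at_within[OF DERIV_bump_int]
          simp: has_real_derivative_iff_has_vector_derivative[symmetric])
    moreover have "(\<lambda>x. indicator {0..1} x *\<^sub>R bump x) = bump"
      by (auto simp: fun_eq_iff indicator_def dest!: bump_neq_0)
    ultimately show ?thesis by (simp add: \<kappa>_def bump_int_0 bump_mass_def)
  qed
  have [measurable]: "bump \<in> borel_measurable borel"
    by (rule borel_measurable_continuous_onI) (intro continuous_intros)
  have [measurable]: "f \<in> borel_measurable borel"
    using f by (rule borel_measurable_continuous_onI)
  \<comment> \<open>The substitution t = N (x - c) moves the scale from the peak into the argument
    of f, where continuity gives the limit.\<close>
  have conc: "integrable lborel (\<lambda>x. f x * (?N n * bump (?N n * (x - c)))) \<and>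
      (LINT x|lborel. f x * (?N n * bump (?N n * (x - c)))) = (LINT t|lborel. f (c + t / ?N n) * bump t)" for n c
  proof -
    have i: "integrable lborel (\<lambda>t. f (c + t / ?N n) * bump t)"
    proof -
      have "integrable lborel (\<lambda>t. indicator {0..1} t *\<^sub>R (f (c + t / ?N n) * bump t))"
        by (rule borel_integrable_compact)
          (auto intro!: continuous_intros continuous_on_compose2[OF f])
      moreover have "(\<lambda>t. indicator {0..1} t *\<^sub>R (f (c + t / ?N n) * bump t)) = (\<lambda>t. f (c + t / ?N n) * bump t)"
        by (auto simp: fun_eq_iff indicator_def dest!: bump_neq_0)
      ultimately show ?thesis by simp
    qed
    have eq: "f (c + (- (?N n * c) + ?N n * x) / ?N n) * bump (- (?N n * c) + ?N n * x)
        = f x * bump (?N n * (x - c))" for x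
    proof -
      have "c + (- (?N n * c) + ?N n * x) / ?N n = x" by (simp add: field_simps)
      moreover have "- (?N n * c) + ?N n * x = ?N n * (x - c)" by (simp add: algebra_simps)
      ultimately show ?thesis by simp
    qed
    from lborel_integrable_real_affine[OF i, of "?N n" "- (?N n * c)"]
    have "integrable lborel (\<lambda>x. f x * bump (?N n * (x - c)))" unfolding eq by simp
    then have 1: "integrable lborel (\<lambda>x. ?N n * (f x * bump (?N n * (x - c))))"
      by (rule integrable_mult_right)
    from lborel_integral_real_affine[of "?N n" "\<lambda>t. f (c + t / ?N n) * bump t" "- (?N n * c)"]
    have "(LINT t|lborel. f (c + t / ?N n) * bump t) = ?N n * (LINT x|lborel. f x * bump (?N n * (x - c)))"
      unfolding eq by simp
    also have "\<dots> = (LINT x|lborel. ?N n * (f x * bump (?N n * (x - c))))" by simp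
    finally show ?thesis using 1 by (simp only: mult.left_commute)
  qed
  have limc: "(\<lambda>n. LINT x|lborel. f x * (?N n * bump (?N n * (x - c)))) \<longlonglongrightarrow> \<kappa> * f c" for c
  proof -
    obtain B where B: "\<And>x. x \<in> {c..c+1} \<Longrightarrow> \<bar>f x\<bar> \<le> B"
      using continuous_on_Icc_abs_bounded[OF continuous_on_subset[OF f subset_UNIV]] by blast
    have "(\<lambda>n. LINT t|lborel. f (c + t / ?N n) * bump t) \<longlonglongrightarrow> (LINT t|lborel. f c * bump t)"
    proof (rule integral_dominated_convergence[where w="\<lambda>t. B * bump t"])
      show "integrable lborel (\<lambda>t. B * bump t)" using intbump by (auto simp: has_bochner_integral_iff)
      show "AE t in lborel. (\<lambda>n. f (c + t / ?N n) * bump t) \<longlonglongrightarrow> f c * bump t"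
      proof (rule AE_I2)
        fix t :: real
        have "(\<lambda>n. t * inverse (?N n)) \<longlonglongrightarrow> t * 0" by (intro tendsto_intros LIMSEQ_inverse_real_of_nat)
        then have "(\<lambda>n. c + t / ?N n) \<longlonglongrightarrow> c + 0" by (intro tendsto_intros) (simp add: divide_inverse)
        moreover have "isCont f c" using f by (simp add: continuous_on_eq_continuous_at)
        ultimately have "(\<lambda>n. f (c + t / ?N n)) \<longlonglongrightarrow> f c" using isCont_tendsto_compose by fastforce
        then show "(\<lambda>n. f (c + t / ?N n) * bump t) \<longlonglongrightarrow> f c * bump t" by (intro tendsto_intros)
      qed
      show "AE t in lborel. norm (f (c + t / ?N n) * bump t) \<le> B * bump t" for n
      proof (rule AE_I2)
        fix t :: real
        show "norm (f (c + t / ?N n) * bump t) \<le> B * bump t"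
        proof (cases "t \<in> {0..1}")
          case True
          then have "c + t / ?N n \<in> {c..c+1}" by (auto simp: field_simps)
          from B[OF this] show ?thesis by (simp add: abs_mult bump_nonneg mult_right_mono)
        qed (use bump_eq_0[of t] in auto)
      qed
    qed measurable
    then show ?thesis using conc intbump by (simp add: has_bochner_integral_iff mult.commute)
  qed
  have g: "set_integrable lborel {s..t} g" for s t using W by (auto simp: has_weak_deriv_def locally_integrable_def)
  have [measurable]: "g \<in> borel_measurable borel"
    using W by (intro locally_integrable_measurable) (simp add: has_weak_deriv_def)
  have cut_meas[measurable]: "cutoff a b (?N n) \<in> borel_measurable borel" for n
    by (rule borel_measurable_continuous_onI, rule DERIV_continuous_on)
      (rule has_field_derivative_at_within[OF DERIV_cutoff])
  have lim1: "(\<lambda>n. LINT x|lborel. f x * deriv (cutoff a b (?N n)) x) \<longlonglongrightarrow> \<kappa> * f a - \<kappa> * f b"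
  proof -
    have "(LINT x|lborel. f x * deriv (cutoff a b (?N n)) x) =
       (LINT x|lborel. f x * (?N n * bump (?N n * (x - a)))) - (LINT x|lborel. f x * (?N n * bump (?N n * (x - b))))" for n
    proof -
      have "deriv (cutoff a b (?N n)) = (\<lambda>x. ?N n * bump (?N n * (x - a)) - ?N n * bump (?N n * (x - b)))"
        using DERIV_cutoff by (auto simp: fun_eq_iff intro!: DERIV_imp_deriv)
      then show ?thesis
        using Bochner_Integration.integral_diff[OF conc[THEN conjunct1, of n a] conc[THEN conjunct1, of n b]]
        by (simp add: right_diff_distrib)
    qed
    then show ?thesis using tendsto_diff[OF limc limc] by presburger
  qed
  \<comment> \<open>The interval is half-open because both steps start to the right of their points:
    at a the cutoff is still 0, and at b its fall has not begun.\<close>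
  have lim2: "(\<lambda>n. LINT x|lborel. g x * cutoff a b (?N n) x) \<longlonglongrightarrow> (LINT x|lborel. \<kappa> * (indicator {a<..b} x * g x))"
  proof (rule integral_dominated_convergence[where w="\<lambda>x. \<kappa> * \<bar>indicator {a..b+1} x *\<^sub>R g x\<bar>"])
    show "integrable lborel (\<lambda>x. \<kappa> * \<bar>indicator {a..b+1} x *\<^sub>R g x\<bar>)"
      using g[of a "b+1"] by (auto simp: set_integrable_def)
    have bnd: "bump_int x \<in> {0..\<kappa>}" for x
      using bump_mass_def bump_int_mono[of x 1] bump_int_mono[of 0 x] bump_int_le_0[of x] bump_int_ge_1[of x] bump_int_0
      by (cases "x \<le> 0"; cases "x \<ge> 1") (auto simp: \<kappa>_def)
    have ge1: "\<forall>\<^sub>F n in sequentially. bump_int (?N n * y) = \<kappa>" if "y > 0" for y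
    proof -
      obtain N :: nat where "1 / y \<le> N" using real_arch_simple by blast
      then have "1 \<le> real N * y" using that by (simp add: field_simps)
      have "1 \<le> ?N n * y" if "n \<ge> N" for n
      proof -
        have "real N * y \<le> ?N n * y" using that \<open>y > 0\<close> by (intro mult_right_mono) auto
        then show ?thesis using \<open>1 \<le> real N * y\<close> by simp
      qed
      then show ?thesis
        by (intro eventually_sequentiallyI[of N]) (use bump_int_ge_1 \<kappa>_def in auto)
    qed
    have le0: "bump_int (?N n * y) = 0" if "y \<le> 0" for y n
      by (rule bump_int_le_0) (use that in \<open>auto simp: mult_le_0_iff\<close>)
    show "AE x in lborel. (\<lambda>n. g x * cutoff a b (?N n) x) \<longlonglongrightarrow> \<kappa> * (indicator {a<..b} x * g x)"
    proof (rule AE_I2)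
      fix x :: real
      consider "x \<le> a" | "a < x" "x \<le> b" | "x > b" by linarith
      then show "(\<lambda>n. g x * cutoff a b (?N n) x) \<longlonglongrightarrow> \<kappa> * (indicator {a<..b} x * g x)"
      proof cases
        case 1
        then show ?thesis using ab le0[of "x - a"] le0[of "x-b"] by (simp add: cutoff_def)
      next
        case 2
        then show ?thesis using ge1[of "x-a"] le0[of "x-b"]
          by (intro tendsto_eventually) (auto simp: cutoff_def)
      next
        case 3
        then have "x - a > 0" "x - b > 0" using ab by auto
        then have "\<forall>\<^sub>F n in sequentially. g x * cutoff a b (?N n) x = \<kappa> * (indicator {a<..b} x * g x)"
          using 3 by (intro eventually_mono[OF eventually_conj[OF ge1 ge1]]) (auto simp: cutoff_def)
        then show ?thesis by (rule tendsto_eventually)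
      qed
    qed
    show "AE x in lborel. norm (g x * cutoff a b (?N n) x) \<le> \<kappa> * \<bar>indicator {a..b+1} x *\<^sub>R g x\<bar>" for n
    proof (rule AE_I2)
      fix x :: real
      have c: "\<bar>cutoff a b (?N n) x\<bar> \<le> \<kappa>"
        using bnd[of "?N n * (x - a)"] bnd[of "?N n * (x - b)"] by (auto simp: cutoff_def)
      have "cutoff a b (?N n) x = 0" if "x \<notin> {a..b+1}"
      proof -
        consider "x < a" | "x > b + 1" using \<open>x \<notin> {a..b+1}\<close> by fastforce
        then show ?thesis
        proof cases
          case 1
          then show ?thesis using ab le0[of "x - a"] le0[of "x-b"] by (simp add: cutoff_def)
        next
          case 2
          have "1 * 1 \<le> ?N n * (x - b)" "1 * 1 \<le> ?N n * (x - a)" by (intro mult_mono; use 2 ab in simp)+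
          then show ?thesis by (simp add: cutoff_def bump_int_ge_1)
        qed
      qed
      then show "norm (g x * cutoff a b (?N n) x) \<le> \<kappa> * \<bar>indicator {a..b+1} x *\<^sub>R g x\<bar>"
        using c by (auto simp: abs_mult indicator_def mult.commute[of \<kappa>] intro!: mult_left_mono)
    qed
  qed (use cut_meas in measurable)
  have eq: "(LINT x|lborel. f x * deriv (cutoff a b (?N n)) x) = - (LINT x|lborel. g x * cutoff a b (?N n) x)" for n
    using W cutoff_test_function[of "?N n" a b] ab unfolding has_weak_deriv_def by auto
  have "\<kappa> * f a - \<kappa> * f b = - (LINT x|lborel. \<kappa> * (indicator {a<..b} x * g x))"
    by (rule LIMSEQ_unique[OF lim1]) (unfold eq, rule tendsto_minus[OF lim2])
  also have "\<dots> = - \<kappa> * (LINT x|lborel. indicator {a<..b} x * g x)" by simp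
  also have "(LINT x|lborel. indicator {a<..b} x * g x) = (LINT t:{a..b}|lborel. g t)"
    unfolding set_lebesgue_integral_def
    by (rule integral_cong_AE, measurable)
       (use AE_lborel_singleton[of a] in eventually_elim, auto simp: indicator_def)
  finally have "\<kappa> * (f b - f a) = \<kappa> * (LINT t:{a..b}|lborel. g t)" by (simp add: algebra_simps)
  then show ?thesis using \<kappa> by simp
qed

text \<open>The positive and negative parts of the truncated difference are densities of two finite
  measures that agree on all half-lines and are therefore equal. Uniqueness of densities equates the
  two parts almost everywhere, and as they are never both positive, both are 0.\<close>

lemma locally_integrable_AE_eq:
  assumes f: "locally_integrable f" and g: "locally_integrable g"
    and eq: "\<And>a b. a \<le> b \<Longrightarrow> (LINT t:{a..b}|lborel. f t) = (LINT t:{a..b}|lborel. g t)"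
  shows "AE x in lborel. f x = g x"
proof -
  have [measurable]: "f \<in> borel_measurable borel" "g \<in> borel_measurable borel"
    using f g by (auto intro: locally_integrable_measurable)
  have "AE x in lborel. \<bar>x\<bar> \<le> real n \<longrightarrow> f x = g x" for n :: nat
  proof -
    define h where "h x = indicator {-real n..real n} x *\<^sub>R (f x - g x)" for x
    have [measurable]: "h \<in> borel_measurable borel" by (auto simp: h_def[abs_def])
    have fi: "set_integrable lborel {a..b} f" "set_integrable lborel {a..b} g" for a b
      using f g by (auto simp: locally_integrable_def)
    have h: "integrable lborel h"
      using set_integral_diff(1)[OF fi, of "-real n" "real n"] by (simp add: set_integrable_def h_def[abs_def])
    have h0: "(LINT x|lborel. indicator {y<..} x *\<^sub>R h x) = 0" for y
    proof -
      have "(LINT x|lborel. indicator {y<..} x *\<^sub>R h x) = (LINT t:{max y (-real n)..real n}|lborel. f t - g t)"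
        unfolding set_lebesgue_integral_def
        by (rule integral_cong_AE, measurable)
          (use AE_lborel_singleton[of y] in eventually_elim, auto simp: indicator_def h_def)
      also have "\<dots> = 0"
      proof (cases "max y (-real n) \<le> real n")
        case True
        then show ?thesis using set_integral_diff(2)[OF fi] eq[OF True] by simp
      qed (simp add: set_lebesgue_integral_def)
      finally show ?thesis .
    qed
    let ?p = "\<lambda>x. ennreal (max 0 (h x))" and ?m = "\<lambda>x. ennreal (max 0 (- h x))"
    have ip: "integrable lborel (\<lambda>x. max 0 (h x))" "integrable lborel (\<lambda>x. max 0 (- h x))"
      using h by (auto intro!: integrable_max)
    have em: "emeasure (density lborel (\<lambda>x. ennreal (F x))) {y<..} = ennreal (LINT x|lborel. indicator {y<..} x *\<^sub>R F x)"
      if "integrable lborel F" "\<And>x. F x \<ge> 0" for y and F :: "real \<Rightarrow> real"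
    proof -
      have [measurable]: "F \<in> borel_measurable borel" using that(1) by auto
      have "emeasure (density lborel (\<lambda>x. ennreal (F x))) {y<..} = (\<integral>\<^sup>+x. ennreal (indicator {y<..} x *\<^sub>R F x) \<partial>lborel)"
        by (subst emeasure_density) (auto simp: indicator_def intro!: nn_integral_cong)
      also have "\<dots> = ennreal (LINT x|lborel. indicator {y<..} x *\<^sub>R F x)"
        by (intro nn_integral_eq_integral integrable_mult_indicator that) (use that in auto)
      finally show ?thesis .
    qed
    have "density lborel ?p = density lborel ?m"
    proof (rule measure_eqI_lessThan)
      fix y
      have "(LINT x|lborel. indicator {y<..} x *\<^sub>R h x) =
          (LINT x|lborel. indicator {y<..} x *\<^sub>R max 0 (h x) - indicator {y<..} x *\<^sub>R max 0 (- h x))"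
        by (rule Bochner_Integration.integral_cong) (auto simp: indicator_def max_def)
      also have "\<dots> = (LINT x|lborel. indicator {y<..} x *\<^sub>R max 0 (h x)) - (LINT x|lborel. indicator {y<..} x *\<^sub>R max 0 (- h x))"
        by (intro Bochner_Integration.integral_diff integrable_mult_indicator ip) auto
      finally show "emeasure (density lborel ?p) {y<..} = emeasure (density lborel ?m) {y<..}"
        using ip h0[of y] by (simp add: em)
      show "emeasure (density lborel ?p) {y<..} < \<infinity>" using ip by (simp add: em)
    qed simp_all
    then have "AE x in lborel. ?p x = ?m x"
      by (intro sigma_finite_measure.density_unique[OF sigma_finite_lborel]) auto
    then have "AE x in lborel. h x = 0"
      by eventually_elim (auto simp: max_def split: if_splits)
    then show ?thesis by eventually_elim (auto simp: h_def indicator_def abs_le_iff split: if_splits)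
  qed
  then have "AE x in lborel. \<forall>n::nat. \<bar>x\<bar> \<le> real n \<longrightarrow> f x = g x"
    by (subst AE_all_countable) auto
  then show ?thesis
    by eventually_elim (use real_arch_simple in blast)
qed

text \<open>This lets a concrete weak derivative replace the chosen \<open>weak_deriv\<close> under
  integrals.\<close>

lemma weak_deriv_AE_unique:
  assumes f: "continuous_on UNIV f" and "has_weak_deriv f g" "has_weak_deriv f h"
  shows "AE x in lborel. g x = h x"
proof (rule locally_integrable_AE_eq)
  show "locally_integrable g" "locally_integrable h" using assms by (auto simp: has_weak_deriv_def)
  fix a b :: real assume "a \<le> b"
  then show "(LINT t:{a..b}|lborel. g t) = (LINT t:{a..b}|lborel. h t)"
    using weak_deriv_continuous_increment[OF f assms(2)] weak_deriv_continuous_increment[OF f assms(3)] by metis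
qed

text \<open>The error of the first-order expansion of \<^term>\<open>P\<close> along \<^term>\<open>f\<close> is locally at most
  \<^term>\<open>\<epsilon>\<close> times the integral of \<^term>\<open>\<bar>g t\<bar>\<close>, and Bolzano's lemma adds these errors up.\<close>

lemma chain_rule_absolutely_continuous:
  fixes f g P P' :: "real \<Rightarrow> real"
  assumes ab: "a \<le> b" and f: "continuous_on {a..b} f" and g: "set_integrable lborel {a..b} g"
    and fg: "\<And>x y. a \<le> x \<Longrightarrow> x \<le> y \<Longrightarrow> y \<le> b \<Longrightarrow> f y - f x = (LINT t:{x..y}|lborel. g t)"
    and P: "\<And>s. s \<in> {l..u} \<Longrightarrow> (P has_real_derivative P' s) (at s within {l..u})"
    and P': "continuous_on {l..u} P'"
    and lu: "\<And>x. x \<in> {a..b} \<Longrightarrow> f x \<in> {l..u}"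
  shows "set_integrable lborel {a..b} (\<lambda>x. P' (f x) * g x)"
    and "P (f b) - P (f a) = (LINT t:{a..b}|lborel. P' (f t) * g t)"
proof -
  have cPf: "continuous_on {a..b} (\<lambda>x. P' (f x))"
    by (rule continuous_on_compose2[OF P' f]) (use lu in auto)
  have [measurable]: "(\<lambda>x. indicator {a..b} x *\<^sub>R P' (f x)) \<in> borel_measurable borel"
    using borel_measurable_continuous_on_indicator[OF _ cPf] by simp
  have [measurable]: "(\<lambda>x. indicator {a..b} x *\<^sub>R g x) \<in> borel_measurable borel"
    using g by (auto simp: set_integrable_def)
  obtain B where B: "\<And>x. x \<in> {a..b} \<Longrightarrow> \<bar>P' (f x)\<bar> \<le> B"
    using continuous_on_Icc_abs_bounded[OF cPf] by blast
  show int: "set_integrable lborel {a..b} (\<lambda>x. P' (f x) * g x)"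
    unfolding set_integrable_def
  proof (rule Bochner_Integration.integrable_bound)
    show "integrable lborel (\<lambda>x. B * (indicator {a..b} x *\<^sub>R g x))"
      using g by (auto simp: set_integrable_def)
    have "(\<lambda>x. (indicator {a..b} x *\<^sub>R P' (f x)) * (indicator {a..b} x *\<^sub>R g x)) \<in> borel_measurable lborel"
      by measurable
    moreover have "(\<lambda>x. (indicator {a..b} x *\<^sub>R P' (f x)) * (indicator {a..b} x *\<^sub>R g x)) =
        (\<lambda>x. indicator {a..b} x *\<^sub>R (P' (f x) * g x))" by (auto simp: indicator_def fun_eq_iff)
    ultimately show "(\<lambda>x. indicator {a..b} x *\<^sub>R (P' (f x) * g x)) \<in> borel_measurable lborel" by simp
    show "AE x in lborel. norm (indicator {a..b} x *\<^sub>R (P' (f x) * g x)) \<le> norm (B * (indicator {a..b} x *\<^sub>R g x))"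
    proof (rule AE_I2)
      fix x
      show "norm (indicator {a..b} x *\<^sub>R (P' (f x) * g x)) \<le> norm (B * (indicator {a..b} x *\<^sub>R g x))"
        using B[of x] by (cases "x \<in> {a..b}") (auto simp: abs_mult intro!: mult_right_mono)
    qed
  qed
  define V where "V x y = (LINT t:{x..y}|lborel. \<bar>g t\<bar>)" for x y
  define I where "I x y = (LINT t:{x..y}|lborel. P' (f t) * g t)" for x y
  have sub: "set_integrable lborel {x..y} g" "set_integrable lborel {x..y} (\<lambda>t. P' (f t) * g t)"
    if "a \<le> x" "y \<le> b" for x y
    using that by (auto intro: set_integrable_subset[OF g] set_integrable_subset[OF int])
  have V0: "V a b \<ge> 0" unfolding V_def set_lebesgue_integral_def by (rule integral_nonneg_AE) auto
  have main: "\<bar>P (f b) - P (f a) - I a b\<bar> \<le> \<epsilon> * V a b" if e: "\<epsilon> > 0" for \<epsilon>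
  proof -
    have "a \<le> a \<and> b \<le> b \<longrightarrow> \<bar>P (f b) - P (f a) - I a b\<bar> \<le> \<epsilon> * V a b"
      using ab
    proof (induction rule: Bolzano[where P="\<lambda>y z. a \<le> y \<and> z \<le> b \<longrightarrow> \<bar>P (f z) - P (f y) - I y z\<bar> \<le> \<epsilon> * V y z"])
      case (trans x y z)
      show ?case
      proof
        assume H: "a \<le> x \<and> z \<le> b"
        have "V x z = V x y + V y z" unfolding V_def
          by (rule set_integral_split_real) (use sub H trans in \<open>auto intro: set_integrable_abs\<close>)
        moreover have "I x z = I x y + I y z" unfolding I_def
          by (rule set_integral_split_real) (use sub H trans in auto)
        ultimately show "\<bar>P (f z) - P (f x) - I x z\<bar> \<le> \<epsilon> * V x z"
          using trans H by (auto simp: algebra_simps)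
      qed
    next
      case (local x)
      then have fx: "f x \<in> {l..u}" using lu by auto
      obtain d1 where d1: "d1 > 0" "\<And>s. s \<in> {l..u} \<Longrightarrow> dist s (f x) < d1 \<Longrightarrow> dist (P' s) (P' (f x)) < \<epsilon>/2"
        using P' fx e unfolding continuous_on_iff by (metis half_gt_zero)
      obtain d where d: "d > 0" "\<And>t. t \<in> {a..b} \<Longrightarrow> dist t x < d \<Longrightarrow> dist (f t) (f x) < d1"
        using f local d1(1) unfolding continuous_on_iff by (metis atLeastAtMost_iff)
      have "a \<le> y \<and> z \<le> b \<longrightarrow> \<bar>P (f z) - P (f y) - I y z\<bar> \<le> \<epsilon> * V y z" if yz: "y \<le> x \<and> x \<le> z \<and> z - y < d" for y z
      proof
        assume H: "a \<le> y \<and> z \<le> b"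
        have near: "dist (P' s) (P' (f x)) < \<epsilon>/2" if "t1 \<in> {y..z}" "t2 \<in> {y..z}" "min (f t1) (f t2) \<le> s" "s \<le> max (f t1) (f t2)" for t1 t2 s
        proof (rule d1(2))
          have "dist t1 x < d" "dist t2 x < d" using that yz by (auto simp: dist_real_def)
          then have "dist (f t1) (f x) < d1" "dist (f t2) (f x) < d1"
            using that yz H by (auto intro!: d(2))
          then show "dist s (f x) < d1" using that by (auto simp: dist_real_def min_def max_def split: if_splits)
          show "s \<in> {l..u}" using lu[of t1] lu[of t2] that H yz by auto
        qed
        \<comment> \<open>The mean value theorem is applied to \<open>P\<close> between two values
          of \<open>f\<close>, since \<open>f\<close> itself may fail to be differentiable.\<close>
        obtain \<xi> where \<xi>: "min (f y) (f z) \<le> \<xi>" "\<xi> \<le> max (f y) (f z)" "P (f z) - P (f y) = P' \<xi> * (f z - f y)"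
        proof (cases "f y = f z")
          case True
          then show ?thesis using that[of "f y"] by auto
        next
          case False
          let ?a = "min (f y) (f z)" and ?b = "max (f y) (f z)"
          have ll: "l \<le> ?a" "?b \<le> u" using lu[of y] lu[of z] H yz by auto
          have "?a < ?b" using False by auto
          moreover have "(P has_derivative (*) (P' s)) (at s within {?a..?b})" if "?a \<le> s" "s \<le> ?b" for s
          proof -
            have "(P has_real_derivative P' s) (at s within {?a..?b})"
              by (rule DERIV_subset[OF P]) (use that ll in auto)
            then show ?thesis by (simp add: has_field_derivative_def)
          qed
          ultimately obtain \<xi> where \<xi>: "\<xi> \<in> {?a<..<?b}" "P ?b - P ?a = P' \<xi> * (?b - ?a)"
            using mvt_simple[of ?a ?b P "\<lambda>s. (*) (P' s)"] by auto
          have "P (f z) - P (f y) = P' \<xi> * (f z - f y)"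
            using \<xi>(2) by (cases "f y \<le> f z") (auto simp: min_def max_def algebra_simps)
          then show ?thesis using that[of \<xi>] \<xi>(1) by auto
        qed
        have gi: "set_integrable lborel {y..z} g" "set_integrable lborel {y..z} (\<lambda>t. P' (f t) * g t)"
          using sub H by auto
        have "P (f z) - P (f y) - I y z = (LINT t:{y..z}|lborel. P' \<xi> * g t) - I y z"
          using \<xi>(3) fg[of y z] H yz by simp
        also have "\<dots> = (LINT t:{y..z}|lborel. P' \<xi> * g t - P' (f t) * g t)"
          unfolding I_def using gi by (intro set_integral_diff(2)[symmetric]) auto
        also have "\<bar>\<dots>\<bar> \<le> (LINT t:{y..z}|lborel. \<bar>P' \<xi> * g t - P' (f t) * g t\<bar>)"
          using set_integral_norm_bound[OF set_integral_diff(1)[OF set_integrable_mult_right[OF gi(1), of "P' \<xi>"] gi(2)]] by simp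
        also have "\<dots> \<le> (LINT t:{y..z}|lborel. \<epsilon> * \<bar>g t\<bar>)"
        proof (rule set_integral_mono)
          show "set_integrable lborel {y..z} (\<lambda>t. \<bar>P' \<xi> * g t - P' (f t) * g t\<bar>)"
            using gi by (intro set_integrable_abs set_integral_diff(1)) auto
          show "set_integrable lborel {y..z} (\<lambda>t. \<epsilon> * \<bar>g t\<bar>)"
            using gi by (intro set_integrable_mult_right set_integrable_abs) auto
          fix t assume t: "t \<in> {y..z}"
          have "dist (P' \<xi>) (P' (f x)) < \<epsilon>/2" using near[of y z \<xi>] \<xi> yz by auto
          moreover have "dist (P' (f t)) (P' (f x)) < \<epsilon>/2" using near[of t t] t by auto
          ultimately have "\<bar>P' \<xi> - P' (f t)\<bar> \<le> \<epsilon>" unfolding dist_real_def by arith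
          then show "\<bar>P' \<xi> * g t - P' (f t) * g t\<bar> \<le> \<epsilon> * \<bar>g t\<bar>"
            unfolding left_diff_distrib[symmetric] abs_mult by (rule mult_right_mono) auto
        qed
        also have "\<dots> = \<epsilon> * V y z" by (simp add: V_def)
        finally show "\<bar>P (f z) - P (f y) - I y z\<bar> \<le> \<epsilon> * V y z" .
      qed
      then show ?case using d(1) by blast
    qed
    then show ?thesis by simp
  qed
  have "P (f b) - P (f a) - I a b = 0"
  proof (rule ccontr)
    assume n: "P (f b) - P (f a) - I a b \<noteq> 0"
    let ?e = "\<bar>P (f b) - P (f a) - I a b\<bar>"
    \<comment> \<open>Half the supposed error is divided by V + 1; the 1 covers the case V =
      0.\<close>
    have "?e \<le> (?e / (2 * (V a b + 1))) * V a b" using n V0 by (intro main) auto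
    also have "\<dots> \<le> ?e / 2"
      using V0 n by (simp add: field_simps)
    finally show False using n by simp
  qed
  then show "P (f b) - P (f a) = (LINT t:{a..b}|lborel. P' (f t) * g t)" by (simp add: I_def)
qed

section \<open>The energy identity\<close>

text \<open>Here w stands for u^2 and g for a weak derivative of it. They are tied together by
  increments rather than by test functions, because this is the form that the chain rule
  uses.\<close>

locale finite_energy =
  fixes w g :: "real \<Rightarrow> real"
  assumes w_cont: "continuous_on UNIV w"
    and w_nonneg: "w x \<ge> 0"
    and w_int: "integrable lborel w"
    and w_sq: "integrable lborel (\<lambda>x. (w x)\<^sup>2)"
    and g_meas: "g \<in> borel_measurable borel"
    and g_sq: "integrable lborel (\<lambda>x. (g x)\<^sup>2)"
    and w_incr: "a \<le> b \<Longrightarrow> w b - w a = (LINT t:{a..b}|lborel. g t)"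

text \<open>The case c = -1 is a reflection, which lets the results on the right half-line serve the
  left one.\<close>

lemma finite_energy_affine:
  assumes "finite_energy w g" "c = 1 \<or> c = -1"
  shows "finite_energy (\<lambda>x. w (d + c * x)) (\<lambda>x. c * g (d + c * x))"
proof -
  interpret finite_energy w g by fact
  have [measurable]: "g \<in> borel_measurable borel" by (rule g_meas)
  have c: "c \<noteq> 0" "c * c = 1" using assms(2) by auto
  show ?thesis
  proof
    show "continuous_on UNIV (\<lambda>x. w (d + c * x))"
      by (intro continuous_on_compose2[OF w_cont] continuous_intros) auto
    show "integrable lborel (\<lambda>x. w (d + c * x))" "integrable lborel (\<lambda>x. (w (d + c * x))\<^sup>2)"
      using lborel_integrable_real_affine[OF w_int] lborel_integrable_real_affine[OF w_sq] c by blast+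
    show "(\<lambda>x. c * g (d + c * x)) \<in> borel_measurable borel" by measurable
    show "integrable lborel (\<lambda>x. (c * g (d + c * x))\<^sup>2)"
      using lborel_integrable_real_affine[OF g_sq c(1), of d] c(2)
      by (simp add: power_mult_distrib power2_eq_square[of c])
    fix a b :: real assume ab: "a \<le> b"
    have "(LINT t:{a..b}|lborel. c * g (d + c * t)) = c * (LINT t|lborel. indicator {a..b} t * g (d + c * t))"
      by (simp add: set_lebesgue_integral_def algebra_simps)
    \<comment> \<open>A reflection reverses the interval, whence \<open>min\<close> and
      \<open>max\<close>.\<close>
    also have "(LINT t|lborel. indicator {a..b} t * g (d + c * t)) = 
        (LINT t|lborel. indicator {min (d+c*a) (d+c*b)..max (d+c*a) (d+c*b)} (d + c * t) * g (d + c * t))"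
      by (rule Bochner_Integration.integral_cong) (use assms(2) ab in \<open>auto simp: indicator_def min_def max_def\<close>)
    also have "\<dots> = (LINT t|lborel. indicator {min (d+c*a) (d+c*b)..max (d+c*a) (d+c*b)} t * g t)"
      using assms(2) by (subst (2) lborel_integral_real_affine[of c _ d]) (auto)
    also have "\<dots> = w (max (d+c*a) (d+c*b)) - w (min (d+c*a) (d+c*b))"
      by (subst w_incr) (auto simp: set_lebesgue_integral_def)
    finally show "w (d + c * b) - w (d + c * a) = (LINT t:{a..b}|lborel. c * g (d + c * t))"
      using assms(2) ab by (auto simp: min_def max_def)
  qed (rule w_nonneg)
qed

context finite_energy
begin

lemma w_meas [measurable]: "w \<in> borel_measurable borel"
  using w_cont by (rule borel_measurable_continuous_onI)

lemma g_locally_integrable: "set_integrable lborel {a..b} g"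
  unfolding set_integrable_def
proof (rule Bochner_Integration.integrable_bound)
  note g_meas [measurable]
  show "integrable lborel (\<lambda>x. indicator {a..b} x + (g x)\<^sup>2)"
    by (intro Bochner_Integration.integrable_add g_sq integrable_real_indicator) (auto simp: emeasure_lborel_Icc_eq)
  show "(\<lambda>x. indicator {a..b} x *\<^sub>R g x) \<in> borel_measurable lborel" by measurable
  have "\<bar>s\<bar> \<le> 1 + s\<^sup>2" for s :: real
    using zero_le_power2[of "\<bar>s\<bar> - 1/2"] by (simp add: power2_eq_square algebra_simps)
  then show "AE x in lborel. norm (indicator {a..b} x *\<^sub>R g x) \<le> norm (indicator {a..b} x + (g x)\<^sup>2)"
    by (intro AE_I2) (auto simp: indicator_def)
qed

text \<open>The square of w has the integrable derivative 2 w g and hence a limit at infinity; a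
  positive limit would contradict the integrability of the square.\<close>

lemma w_tendsto_0_at_top: "(w \<longlongrightarrow> 0) at_top"
proof -
  note g_meas [measurable]
  have i: "integrable lborel (\<lambda>x. 2 * w x * g x)"
  proof (rule Bochner_Integration.integrable_bound)
    show "integrable lborel (\<lambda>x. (w x)\<^sup>2 + (g x)\<^sup>2)" by (intro Bochner_Integration.integrable_add w_sq g_sq)
    show "(\<lambda>x. 2 * w x * g x) \<in> borel_measurable lborel" by measurable
    have "\<bar>2 * r * s\<bar> \<le> r\<^sup>2 + s\<^sup>2" for r s :: real
      using sum_squares_bound[of "\<bar>r\<bar>" "\<bar>s\<bar>"] by (simp add: abs_mult)
    then show "AE x in lborel. norm (2 * w x * g x) \<le> norm ((w x)\<^sup>2 + (g x)\<^sup>2)"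
      by (intro AE_I2) auto
  qed
  have incr: "(w b)\<^sup>2 = (w 0)\<^sup>2 + (LINT t:{0..b}|lborel. 2 * w t * g t)" if b: "0 \<le> b" for b
  proof -
    obtain B where B: "\<And>x. x \<in> {0..b} \<Longrightarrow> \<bar>w x\<bar> \<le> B"
      using continuous_on_Icc_abs_bounded[OF continuous_on_subset[OF w_cont subset_UNIV]] by blast
    have "(w b)\<^sup>2 - (w 0)\<^sup>2 = (LINT t:{0..b}|lborel. 2 * w t * g t)"
      by (rule chain_rule_absolutely_continuous(2)[where l=0 and u=B and P="\<lambda>s. s\<^sup>2" and P'="\<lambda>s. 2 * s" and f=w and g=g])
        (use b B w_nonneg g_locally_integrable w_incr in \<open>auto intro!: derivative_eq_intros continuous_intros continuous_on_subset[OF w_cont] simp: abs_le_iff\<close>)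
    then show ?thesis by simp
  qed
  have si: "set_integrable lborel {0..} (\<lambda>x. 2 * w x * g x)"
    unfolding set_integrable_def by (rule integrable_mult_indicator[OF _ i]) simp
  define L where "L = (w 0)\<^sup>2 + (LINT t:{0..}|lborel. 2 * w t * g t)"
  have lim: "((\<lambda>b. (w 0)\<^sup>2 + (LINT t:{0..b}|lborel. 2 * w t * g t)) \<longlongrightarrow> L) at_top"
    unfolding L_def by (intro tendsto_intros tendsto_set_lebesgue_integral_at_top si) simp
  have L: "((\<lambda>b. (w b)\<^sup>2) \<longlongrightarrow> L) at_top"
    by (rule Lim_transform_eventually[OF lim], rule eventually_mono[OF eventually_ge_at_top[of 0]]) (rule incr[symmetric])
  have "L \<ge> 0" by (rule tendsto_lowerbound[OF L]) auto
  have "L = 0"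
  proof (rule ccontr)
    assume "L \<noteq> 0"
    then have "L > 0" using \<open>L \<ge> 0\<close> by simp
    then have "\<forall>\<^sub>F b in at_top. (w b)\<^sup>2 > L / 2" using order_tendstoD(1)[OF L, of "L/2"] by simp
    then obtain N where N: "\<And>x. x \<ge> N \<Longrightarrow> (w x)\<^sup>2 > L / 2" by (auto simp: eventually_at_top_linorder)
    \<comment> \<open>Beyond N the square exceeds L/2, so an interval of length k contributes at
      least k L/2.\<close>
    have "real k * (L / 2) \<le> (LINT x|lborel. (w x)\<^sup>2)" for k :: nat
    proof -
      have "real k * (L / 2) = (LINT x|lborel. indicator {N..N + real k} x * (L/2))" by simp
      also have "\<dots> \<le> (LINT x|lborel. (w x)\<^sup>2)"
        using N by (intro integral_mono w_sq integrable_mult_left integrable_real_indicator) (auto simp: indicator_def less_imp_le emeasure_lborel_Icc_eq)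
      finally show ?thesis .
    qed
    moreover obtain k :: nat where "k > (LINT x|lborel. (w x)\<^sup>2) / (L / 2)" using reals_Archimedean2 by blast
    ultimately show False using \<open>L > 0\<close> by (simp add: field_simps not_le[symmetric])
  qed
  with L have "((\<lambda>b. sqrt ((w b)\<^sup>2)) \<longlongrightarrow> sqrt 0) at_top" by (intro tendsto_intros) simp
  then show ?thesis using w_nonneg by simp
qed

lemma w_tendsto_0_at_bot: "(w \<longlongrightarrow> 0) at_bot"
proof -
  interpret r: finite_energy "\<lambda>x. w (0 + (-1) * x)" "\<lambda>x. (-1) * g (0 + (-1) * x)"
    by (rule finite_energy_affine) (auto intro: finite_energy_axioms)
  show ?thesis using r.w_tendsto_0_at_top by (simp add: filterlim_at_bot_mirror)
qed

text \<open>Outside a compact interval w stays below one of its positive values, so the maximum over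
  that interval is global.\<close>

lemma w_attains_max:
  assumes "(LINT x|lborel. w x) > 0"
  obtains x0 where "w x0 > 0" "\<And>x. w x \<le> w x0"
proof -
  have "\<exists>x. w x > 0"
  proof (rule ccontr)
    assume "\<nexists>x. w x > 0"
    then have "w = (\<lambda>x. 0)" using w_nonneg by (auto simp: fun_eq_iff not_less intro: antisym)
    then show False using assms by simp
  qed
  then obtain x1 where x1: "w x1 > 0" by blast
  have "\<forall>\<^sub>F x in at_top. w x < w x1" "\<forall>\<^sub>F x in at_bot. w x < w x1"
    using order_tendstoD(2)[OF w_tendsto_0_at_top x1] order_tendstoD(2)[OF w_tendsto_0_at_bot x1] by auto
  then obtain a b where ab: "\<And>x. x \<ge> b \<Longrightarrow> w x < w x1" "\<And>x. x \<le> a \<Longrightarrow> w x < w x1"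
    by (auto simp: eventually_at_top_linorder eventually_at_bot_linorder)
  have x1ab: "x1 \<in> {a..b}" using ab[of x1] by (meson atLeastAtMost_iff less_irrefl linear)
  then obtain x0 where x0: "x0 \<in> {a..b}" "\<And>x. x \<in> {a..b} \<Longrightarrow> w x \<le> w x0"
    using continuous_attains_sup[of "{a..b}" w] continuous_on_subset[OF w_cont subset_UNIV] by blast
  have "w x1 \<le> w x0" using x0 x1ab by blast
  have "w x \<le> w x0" for x
  proof (cases "x \<in> {a..b}")
    case False
    then have "w x < w x1" using ab[of x] by (auto simp: not_le less_imp_le)
    with \<open>w x1 \<le> w x0\<close> show ?thesis by simp
  qed (rule x0(2))
  moreover have "w x0 > 0" using \<open>w x1 \<le> w x0\<close> x1 by simp
  ultimately show ?thesis using that by blast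
qed

end

section \<open>The potential and the action of one flank\<close>

definition potential :: "real \<Rightarrow> real \<Rightarrow> real \<Rightarrow> real" where
  "potential p m s = (m powr (p/2 - 1) * s - s powr (p/2)) / p"

text \<open>The constant K of the overview: the absolute value of the cross term of the square,
  integrated over one flank of a peak of height 1.\<close>

definition unit_action :: "real \<Rightarrow> real" where
  "unit_action p = integral {0..1} (\<lambda>t. sqrt (potential p 1 t / 2))"

lemma potential_scale:
  assumes "m > 0" "p > 2" "0 \<le> t"
  shows "potential p m (m * t) = m powr (p/2) * potential p 1 t"
proof -
  have "m powr (p/2) = m powr (p/2 - 1) * m"
    using assms powr_add[of m "p/2 - 1" 1] by simp
  then show ?thesis using assms by (simp add: potential_def powr_mult field_simps)
qed

lemma potential_nonneg:
  assumes "p > 2" "0 \<le> s" "s \<le> m"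
  shows "potential p m s \<ge> 0"
proof (cases "s = 0")
  case False
  then have "s powr (p/2) = s powr (p/2 - 1) * s"
    using assms powr_add[of s "p/2 - 1" 1] by simp
  also have "\<dots> \<le> m powr (p/2 - 1) * s"
    using assms by (intro mult_right_mono powr_mono2) auto
  finally show ?thesis using assms by (simp add: potential_def)
qed (use assms in \<open>simp add: potential_def\<close>)

lemma potential_pos:
  assumes "p > 2" "0 < s" "s < m"
  shows "potential p m s > 0"
proof -
  have "s powr (p/2) = s powr (p/2 - 1) * s"
    using assms powr_add[of s "p/2 - 1" 1] by simp
  also have "\<dots> < m powr (p/2 - 1) * s"
    using assms by (intro mult_strict_right_mono powr_less_mono2) auto
  finally show ?thesis using assms by (simp add: potential_def)
qed

lemma potential_0 [simp]: "potential p m 0 = 0"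
  by (simp add: potential_def)

lemma continuous_on_potential [continuous_intros]:
  assumes "p > 2" "continuous_on S f" "\<And>x. x \<in> S \<Longrightarrow> f x \<ge> 0"
  shows "continuous_on S (\<lambda>x. potential p m (f x))"
  unfolding potential_def using assms by (intro continuous_intros continuous_on_powr') auto

text \<open>An antiderivative of \<open>sqrt (potential p m s / 2)\<close> in s. It is written
  through the case m = 1 so that its value at m is an exact power of m times
  \<open>unit_action p\<close>: the root contributes m^(p/4) and the rescaled variable contributes
  m.\<close>

definition action :: "real \<Rightarrow> real \<Rightarrow> real \<Rightarrow> real" where
  "action p m s = m powr (1 + p/4) * integral {0..s/m} (\<lambda>t. sqrt (potential p 1 t / 2))"

lemma action_0: "action p m 0 = 0"
  and action_max: "m > 0 \<Longrightarrow> action p m m = m powr (1 + p/4) * unit_action p"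
  by (simp_all add: action_def unit_action_def)

text \<open>One-sided derivatives at the ends are included because w attains m and may attain 0, so
  the chain rule has to cover the closed interval.\<close>

lemma DERIV_action:
  assumes p: "p > 2" and m: "m > 0" and s: "s \<in> {0..m}"
  shows "(action p m has_real_derivative sqrt (potential p m s / 2)) (at s within {0..m})"
proof -
  let ?f = "\<lambda>t. sqrt (potential p 1 t / 2)"
  have 1: "((\<lambda>t. integral {0..t} ?f) has_real_derivative ?f (s/m)) (at (s/m) within {0..1})"
    by (rule integral_has_real_derivative) (use p s m in \<open>auto intro!: continuous_intros\<close>)
  have 2: "((\<lambda>s. s / m) has_real_derivative 1 / m) (at s within {0..m})"
    using m by (auto intro!: derivative_eq_intros)
  have "(\<lambda>s. s / m) ` {0..m} \<subseteq> {0..1}" using m by (auto simp: field_simps)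
  from DERIV_image_chain[OF DERIV_subset[OF 1 this] 2]
  have "((\<lambda>s. integral {0..s/m} ?f) has_real_derivative ?f (s/m) * (1/m)) (at s within {0..m})"
    by (simp add: o_def)
  then have 3: "(action p m has_real_derivative m powr (1 + p/4) * (?f (s/m) * (1/m))) (at s within {0..m})"
    unfolding action_def[abs_def] by (rule DERIV_cmult)
  have "m powr (1 + p/4) * (?f (s/m) * (1/m)) = m powr (p/4) * ?f (s/m)"
    using m by (simp add: powr_add)
  also have "m powr (p/4) = sqrt (m powr (p/2))"
    using m by (simp add: powr_half_sqrt[symmetric] powr_powr)
  also have "\<dots> * ?f (s/m) = sqrt (m powr (p/2) * potential p 1 (s/m) / 2)"
    by (simp add: real_sqrt_mult[symmetric])
  also have "m powr (p/2) * potential p 1 (s/m) = potential p m s"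
    using potential_scale[of m p "s/m"] m p s by simp
  finally show ?thesis using 3 by simp
qed

section \<open>The energy identity for a function with a given peak\<close>

locale bounded_energy = finite_energy +
  fixes p m x0 :: real
  assumes p: "p > 2" and m: "m > 0" and w_le: "w x \<le> m" and w_x0: "w x0 = m"
begin

abbreviation "G x \<equiv> potential p m (w x)"

definition defect :: "real \<Rightarrow> real" where
  "defect x = (if x \<le> x0 then (g x / sqrt 8 - sqrt (G x))\<^sup>2 else (g x / sqrt 8 + sqrt (G x))\<^sup>2)"

lemma G_nonneg: "G x \<ge> 0" using potential_nonneg[OF p w_nonneg w_le] .

lemma G_cont: "continuous_on S (\<lambda>x. G x)"
  by (intro continuous_on_potential p continuous_on_subset[OF w_cont]) (auto simp: w_nonneg)

lemma G_meas [measurable]: "(\<lambda>x. G x) \<in> borel_measurable borel"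
  by (rule borel_measurable_continuous_onI[OF G_cont])

lemma w_powr_int: "integrable lborel (\<lambda>x. w x powr (p/2))"
proof (rule Bochner_Integration.integrable_bound)
  show "integrable lborel (\<lambda>x. m powr (p/2 - 1) * w x)" using w_int by simp
  show "(\<lambda>x. w x powr (p/2)) \<in> borel_measurable lborel" by measurable
  show "AE x in lborel. norm (w x powr (p/2)) \<le> norm (m powr (p/2 - 1) * w x)"
  proof (rule AE_I2)
    fix x
    \<comment> \<open>Nonnegativity of the potential is exactly the bound of w^(p/2) by m^(p/2 - 1)
      w.\<close>
    have "0 \<le> G x" by (rule G_nonneg)
    then show "norm (w x powr (p/2)) \<le> norm (m powr (p/2 - 1) * w x)"
      using p w_nonneg[of x] by (simp add: potential_def field_simps)
  qed
qed

lemma G_int: "integrable lborel (\<lambda>x. G x)"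
  unfolding potential_def using w_int w_powr_int by auto

text \<open>The cross term is the derivative of the action along w. Its integral therefore depends
  only on the values of w at x0 and at infinity, which are m and 0, and not on the shape in
  between.\<close>

lemma half_line_energy:
  shows "set_integrable lborel {x0..} (\<lambda>x. (g x / sqrt 8 + sqrt (G x))\<^sup>2)"
    and "(LINT x:{x0..}|lborel. (g x)\<^sup>2 / 8 + G x) =
         (LINT x:{x0..}|lborel. (g x / sqrt 8 + sqrt (G x))\<^sup>2) + m powr (1 + p/4) * unit_action p"
proof -
  note g_meas [measurable]
  let ?h = "\<lambda>x. sqrt (G x / 2) * g x"
  have i1: "integrable lborel (\<lambda>x. (g x)\<^sup>2 / 8 + G x)" using g_sq G_int by auto
  have i2: "integrable lborel ?h"
  proof (rule Bochner_Integration.integrable_bound[OF i1])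
    show "?h \<in> borel_measurable lborel" by measurable
    show "AE x in lborel. norm (?h x) \<le> norm ((g x)\<^sup>2 / 8 + G x)"
    proof (rule AE_I2)
      fix x
      \<comment> \<open>The cross term is dominated by the sum of the two squares and is therefore
        integrable.\<close>
      have "2 * (\<bar>g x\<bar> / sqrt 8) * sqrt (G x) \<le> (\<bar>g x\<bar> / sqrt 8)\<^sup>2 + (sqrt (G x))\<^sup>2"
        by (rule sum_squares_bound)
      moreover have "2 * (\<bar>g x\<bar> / sqrt 8) * sqrt (G x) = sqrt (G x / 2) * \<bar>g x\<bar>"
        using real_sqrt_mult[of 4 2] by (simp add: real_sqrt_divide)
      ultimately show "norm (?h x) \<le> norm ((g x)\<^sup>2 / 8 + G x)"
        using G_nonneg[of x] by (simp add: abs_mult power_divide)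
    qed
  qed
  have set: "set_integrable lborel A f" if "integrable lborel f" "A \<in> sets borel" for A and f :: "real \<Rightarrow> real"
    unfolding set_integrable_def by (rule integrable_mult_indicator) (use that in auto)
  have "((\<lambda>b. LINT x:{x0..b}|lborel. ?h x) \<longlongrightarrow> (LINT x:{x0..}|lborel. ?h x)) at_top"
    by (rule tendsto_set_lebesgue_integral_at_top) (auto intro: set[OF i2])
  moreover have "(LINT x:{x0..b}|lborel. ?h x) = action p m (w b) - action p m m" if "b \<ge> x0" for b
  proof -
    have "action p m (w b) - action p m (w x0) = (LINT x:{x0..b}|lborel. ?h x)"
    proof (rule chain_rule_absolutely_continuous(2)[where f=w and l=0 and u=m and P'="\<lambda>s. sqrt (potential p m s / 2)"])
      show "continuous_on {0..m} (\<lambda>s. sqrt (potential p m s / 2))"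
        using p by (intro continuous_intros) auto
    qed (use that DERIV_action[OF p m] w_nonneg w_le g_locally_integrable w_incr in
         \<open>auto intro: continuous_on_subset[OF w_cont]\<close>)
    then show ?thesis by (simp add: w_x0)
  qed
  ultimately have T1: "((\<lambda>b. action p m (w b) - action p m m) \<longlongrightarrow> (LINT x:{x0..}|lborel. ?h x)) at_top"
    by (rule Lim_transform_eventually[OF _ eventually_mono[OF eventually_ge_at_top[of x0]]])
  have T2: "((\<lambda>b. action p m (w b) - action p m m) \<longlongrightarrow> action p m 0 - action p m m) at_top"
  proof (intro tendsto_intros)
    have c: "continuous_on {0..m} (action p m)"
      by (rule DERIV_continuous_on) (rule DERIV_action[OF p m])
    show "((\<lambda>b. action p m (w b)) \<longlongrightarrow> action p m 0) at_top"
      by (rule continuous_on_tendsto_compose[OF c w_tendsto_0_at_top]) (use m w_nonneg w_le in auto)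
  qed
  have H: "(LINT x:{x0..}|lborel. ?h x) = - (m powr (1 + p/4) * unit_action p)"
    using tendsto_unique[OF _ T1 T2] by (simp add: action_0 action_max[OF m])
  have eq: "(g x / sqrt 8 + sqrt (G x))\<^sup>2 = ((g x)\<^sup>2 / 8 + G x) + ?h x" for x
    using G_nonneg[of x] real_sqrt_mult[of 4 2] by (simp add: power2_sum power_divide real_sqrt_divide)
  show "set_integrable lborel {x0..} (\<lambda>x. (g x / sqrt 8 + sqrt (G x))\<^sup>2)"
    unfolding eq by (intro set_integral_add set i1 i2) auto
  have "(LINT x:{x0..}|lborel. (g x / sqrt 8 + sqrt (G x))\<^sup>2) =
      (LINT x:{x0..}|lborel. (g x)\<^sup>2 / 8 + G x) + (LINT x:{x0..}|lborel. ?h x)"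
    unfolding eq by (intro set_integral_add set i1 i2) auto
  then show "(LINT x:{x0..}|lborel. (g x)\<^sup>2 / 8 + G x) =
         (LINT x:{x0..}|lborel. (g x / sqrt 8 + sqrt (G x))\<^sup>2) + m powr (1 + p/4) * unit_action p"
    using H by simp
qed

end

lemma bounded_energy_affine:
  assumes "bounded_energy w g p m x0" "c = 1 \<or> c = -1"
  shows "bounded_energy (\<lambda>x. w (d + c * x)) (\<lambda>x. c * g (d + c * x)) p m ((x0 - d) * c)"
proof -
  interpret bounded_energy w g p m x0 by fact
  interpret r: finite_energy "\<lambda>x. w (d + c * x)" "\<lambda>x. c * g (d + c * x)"
    by (rule finite_energy_affine) (use assms(2) finite_energy_axioms in auto)
  show ?thesis
    by standard (use p m w_le w_x0 assms(2) in auto)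
qed

context bounded_energy
begin

lemma energy_identity:
  shows "integrable lborel defect"
    and "(LINT x|lborel. (g x)\<^sup>2) / 8 - (LINT x|lborel. w x powr (p/2)) / p =
      (LINT x|lborel. defect x) + 2 * unit_action p * m powr (1 + p/4) - m powr (p/2 - 1) / p * (LINT x|lborel. w x)"
proof -
  note g_meas [measurable]
  interpret r: bounded_energy "\<lambda>x. w (0 + (-1) * x)" "\<lambda>x. (-1) * g (0 + (-1) * x)" p m "(x0 - 0) * (-1)"
    by (rule bounded_energy_affine) (auto intro: bounded_energy_axioms)
  have i1: "integrable lborel (\<lambda>x. (g x)\<^sup>2 / 8 + G x)" using g_sq G_int by auto
  have set: "set_integrable lborel A f" if "integrable lborel f" "A \<in> sets borel" for A and f :: "real \<Rightarrow> real"
    unfolding set_integrable_def by (rule integrable_mult_indicator) (use that in auto)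
  let ?L = "\<lambda>x. (g x / sqrt 8 - sqrt (G x))\<^sup>2" and ?R = "\<lambda>x. (g x / sqrt 8 + sqrt (G x))\<^sup>2"
  have sqm: "(b - a)\<^sup>2 = (a - b)\<^sup>2" for a b :: real
    by (simp_all add: power2_eq_square algebra_simps)
  have setm: "{x. - x \<le> x0} = {- x0..}" by auto
  \<comment> \<open>This is the identity of the right half-line for the reflected function.
    Reflection changes the sign of g, which turns the plus in the square into a minus.\<close>
  have L: "(LINT x:{..x0}|lborel. (g x)\<^sup>2 / 8 + G x) = (LINT x:{..x0}|lborel. ?L x) + m powr (1 + p/4) * unit_action p"
    using r.half_line_energy(2) by (subst (1 2) set_integral_reflect) (simp add: setm sqm)
  have Li: "set_integrable lborel {..x0} ?L"
  proof -
    have "integrable lborel (\<lambda>x. indicator {- x0..} (0 + (-1) * x) *\<^sub>R ((-1) * g (0 + (-1) * (0 + (-1) * x)) / sqrt 8 + sqrt (potential p m (w (0 + (-1) * (0 + (-1) * x)))))\<^sup>2)"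
      by (rule lborel_integrable_real_affine) (use r.half_line_energy(1) in \<open>simp_all add: set_integrable_def\<close>)
    moreover have "indicat_real {- x0..} (- x) = indicator {..x0} x" for x by (simp add: indicator_def)
    ultimately show ?thesis by (simp add: set_integrable_def sqm)
  qed
  note R = half_line_energy
  have dl: "set_integrable lborel {..x0} defect" 
    by (rule set_integrable_cong[OF refl refl, THEN iffD2, OF _ Li]) (auto simp: defect_def)
  have dr: "set_integrable lborel {x0<..} defect" 
    by (rule set_integrable_cong[OF refl refl, THEN iffD2, OF _ set_integrable_subset[OF R(1)]]) (auto simp: defect_def)
  have U: "{..x0} \<union> {x0<..} = UNIV" and disj: "{..x0} \<inter> {x0<..} = {}" by auto
  \<comment> \<open>\<open>defect\<close> changes its branch just after x0, while the half-line
    identity includes x0; a single point does not affect the integral.\<close>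
  have closed: "(LINT x:{x0<..}|lborel. f x) = (LINT x:{x0..}|lborel. f x)" if [measurable]: "f \<in> borel_measurable borel" for f :: "real \<Rightarrow> real"
    unfolding set_lebesgue_integral_def
    by (rule integral_cong_AE, measurable) (use AE_lborel_singleton[of x0] in eventually_elim, auto simp: indicator_def)
  show "integrable lborel defect" using set_integrable_Un[OF dl dr] U by (simp add: set_integrable_def)
  have "(LINT x|lborel. (g x)\<^sup>2 / 8 + G x) = (LINT x:{..x0}|lborel. (g x)\<^sup>2 / 8 + G x) + (LINT x:{x0<..}|lborel. (g x)\<^sup>2 / 8 + G x)"
    using set_integral_Un[OF disj set[OF i1, of "{..x0}"] set[OF i1, of "{x0<..}"]] U by (simp add: set_lebesgue_integral_def)
  also have "\<dots> = (LINT x:{..x0}|lborel. ?L x) + (LINT x:{x0<..}|lborel. ?R x) + 2 * unit_action p * m powr (1 + p/4)"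
    using L R(2) by (simp add: closed)
  also have "(LINT x:{..x0}|lborel. ?L x) = (LINT x:{..x0}|lborel. defect x)"
    by (rule set_lebesgue_integral_cong) (auto simp: defect_def)
  also have "(LINT x:{x0<..}|lborel. ?R x) = (LINT x:{x0<..}|lborel. defect x)"
    by (rule set_lebesgue_integral_cong) (auto simp: defect_def)
  also have "(LINT x:{..x0}|lborel. defect x) + (LINT x:{x0<..}|lborel. defect x) = (LINT x|lborel. defect x)"
    using set_integral_Un[OF disj dl dr] U by (simp add: set_lebesgue_integral_def)
  finally have "(LINT x|lborel. (g x)\<^sup>2 / 8 + G x) = (LINT x|lborel. defect x) + 2 * unit_action p * m powr (1 + p/4)" .
  \<comment> \<open>The linear part of the potential yields the mass term, its power the nonlinear
    term of the energy.\<close>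
  moreover have "(LINT x|lborel. (g x)\<^sup>2 / 8 + G x) = (LINT x|lborel. (g x)\<^sup>2) / 8 +
     (m powr (p/2 - 1) * (LINT x|lborel. w x) - (LINT x|lborel. w x powr (p/2))) / p"
    unfolding potential_def using g_sq w_int w_powr_int by simp
  ultimately show "(LINT x|lborel. (g x)\<^sup>2) / 8 - (LINT x|lborel. w x powr (p/2)) / p =
      (LINT x|lborel. defect x) + 2 * unit_action p * m powr (1 + p/4) - m powr (p/2 - 1) / p * (LINT x|lborel. w x)"
    by (simp add: diff_divide_distrib)
qed

end

section \<open>The compacton profile\<close>

text \<open>For r > 0 this writes 1 - (1 - t)^r as t times a factor that is positive and continuous
  on [0, 1], the derivative r filling the gap at 0. With t = z^2 and r = p - 2 the square root in
  the profile equation becomes z (up to sign) times a positive continuous factor.\<close>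

definition chord_slope :: "real \<Rightarrow> real \<Rightarrow> real" where
  "chord_slope r t = (if t = 0 then r else (1 - (1 - t) powr r) / t)"

lemma chord_slope_mult: "t * chord_slope r t = 1 - (1 - t) powr r"
  by (simp add: chord_slope_def)

lemma chord_slope_pos:
  assumes "r > 0" "0 \<le> t" "t \<le> 1"
  shows "chord_slope r t > 0"
proof (cases "t = 0")
  case False
  then have "(1 - t) powr r < 1 powr r" using assms by (intro powr_less_mono2) auto
  then show ?thesis using False assms by (simp add: chord_slope_def)
qed (use assms in \<open>simp add: chord_slope_def\<close>)

lemma continuous_on_chord_slope:
  assumes r: "r > 0"
  shows "continuous_on {0..1} (chord_slope r)"
  unfolding continuous_on_eq_continuous_within
proof
  fix t :: real assume t: "t \<in> {0..1}"
  show "continuous (at t within {0..1}) (chord_slope r)"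
  proof (cases "t = 0")
    case True
    have "((\<lambda>t. 1 - (1 - t) powr r) has_real_derivative r) (at 0)"
      by (auto intro!: derivative_eq_intros)
    then have "((\<lambda>h. (1 - (1 - h) powr r) / h) \<longlongrightarrow> r) (at 0)"
      by (simp add: DERIV_def)
    then have "(chord_slope r \<longlongrightarrow> r) (at 0)"
      by (rule Lim_transform_eventually) (auto simp: eventually_at_filter chord_slope_def)
    then have "isCont (chord_slope r) 0" by (simp add: isCont_def chord_slope_def)
    then show ?thesis using True continuous_at_imp_continuous_at_within by blast
  next
    case False
    \<comment> \<open>At t = 1 the base of the power is 0; the positive exponent keeps it
      continuous.\<close>
    have "continuous_on {0<..1} (\<lambda>t. (1 - (1 - t) powr r) / t)"
      using r by (intro continuous_intros continuous_on_powr') auto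
    then have "continuous_on {0<..1} (chord_slope r)"
      by (rule continuous_on_eq) (auto simp: chord_slope_def)
    then have "continuous (at t within {0<..1}) (chord_slope r)"
      using t False by (auto simp: continuous_on_eq_continuous_within)
    moreover have "at t within {0<..1} = at t within {0..1}"
      by (rule at_within_nhd[where S="{0<..}"]) (use t False in auto)
    ultimately show ?thesis by simp
  qed
qed

text \<open>Squaring removes the corner. This makes the squared profile differentiable across the
  edge of its support.\<close>

lemma DERIV_max_0_power2: "((\<lambda>u. (max 0 u)\<^sup>2) has_real_derivative 2 * max 0 u) (at u)"
proof -
  consider "u > 0" | "u < 0" | "u = 0" by linarith
  then show ?thesis
  proof cases
    case 1
    have "((\<lambda>u. u\<^sup>2) has_real_derivative 2 * max 0 u) (at u)"
      using 1 by (auto intro!: derivative_eq_intros)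
    then show ?thesis
      by (rule has_field_derivative_transform_within_open[where S="{0<..}"]) (use 1 in auto)
  next
    case 2
    have "((\<lambda>u. 0) has_real_derivative 2 * max 0 u) (at u)"
      using 2 by (auto intro!: derivative_eq_intros)
    then show ?thesis
      by (rule has_field_derivative_transform_within_open[where S="{..<0}"]) (use 2 in auto)
  next
    case 3
    have "((\<lambda>h::real. max 0 h) \<longlongrightarrow> max 0 0) (at 0)" by (intro tendsto_intros)
    then have "((\<lambda>h::real. ((max 0 (0 + h))\<^sup>2 - (max 0 0)\<^sup>2) / h) \<longlongrightarrow> 0) (at 0)"
      by (subst (asm) max.idem, elim Lim_transform_eventually)
        (auto simp: eventually_at_filter max_def power2_eq_square)
    then show ?thesis using 3 by (simp add: DERIV_def)
  qed
qed

locale profile =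
  fixes p m :: real
  assumes p: "p > 2" and m: "m > 0"
begin

text \<open>The value for which the first integral with B = 0 holds at height sqrt m and slope 0,
  that is, at the peak of the profile.\<close>

definition "c = 2 / p * m powr (p/2 - 1)"

lemma c_pos: "c > 0" using p m by (simp add: c_def)

text \<open>With \<^term>\<open>\<phi> = sqrt m * (1 - z\<^sup>2)\<close> the equation \<^term>\<open>\<phi>' = - sqrt (c - 2/p * \<phi> powr (p - 2))\<close>
  becomes \<^term>\<open>z' = 1 / speed z\<close>, which is regular both at the peak and at the edge of the support.\<close>

definition speed :: "real \<Rightarrow> real" where
  "speed z = 2 * sqrt m / (sqrt c * sqrt (chord_slope (p - 2) (min 1 (z\<^sup>2))))"

text \<open>The position as a function of z, so that the equation for z is solved by one integration
  and an inversion. The \<open>min 1\<close> in \<open>speed\<close> makes it constant beyond |z| =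
  1, so that \<open>pos\<close> is a bijection of the whole line.\<close>

definition pos :: "real \<Rightarrow> real" where
  "pos z = (LBINT y=0..z. speed y)"

lemma slope_pos: "chord_slope (p - 2) (min 1 (z\<^sup>2)) > 0"
  using p by (intro chord_slope_pos) auto

lemma slope_cont: "continuous_on S f \<Longrightarrow> continuous_on S (\<lambda>x. chord_slope (p - 2) (min 1 ((f x)\<^sup>2)))"
  using p by (intro continuous_on_compose2[OF continuous_on_chord_slope] continuous_intros) auto

lemma speed_pos: "speed z > 0"
  using m c_pos slope_pos by (simp add: speed_def)

lemma speed_cont: "continuous_on S speed"
  unfolding speed_def
  by (intro continuous_intros slope_cont) (use c_pos slope_pos less_imp_neq in \<open>auto simp: less_imp_neq[THEN not_sym]\<close>)

lemma DERIV_pos: "(pos has_real_derivative speed z) (at z)"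
proof -
  let ?a = "min z 0 - 1" and ?b = "max z 0 + 1"
  have "((\<lambda>u. LBINT y=0..u. speed y) has_vector_derivative (speed z)) (at z within {?a..?b})"
    using interval_integral_FTC2[of ?a 0 ?b speed z] by (auto simp: zero_ereal_def speed_cont)
  then have "((\<lambda>u. LBINT y=0..u. speed y) has_vector_derivative (speed z)) (at z)"
    by (subst (asm) at_within_interior) (auto simp: interior_atLeastAtMost_real)
  then show ?thesis
    by (simp add: has_real_derivative_iff_has_vector_derivative pos_def[abs_def])
qed

lemma pos_0 [simp]: "pos 0 = 0" by (simp add: pos_def zero_ereal_def)

lemma pos_minus: "pos (- z) = - pos z"
proof -
  have "((\<lambda>z. pos z + pos (- z)) has_real_derivative 0) (at z)" for z
    using DERIV_pos
    by (auto intro!: derivative_eq_intros DERIV_chain2[OF DERIV_pos] simp: speed_def)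
  from DERIV_isconst_all[OF allI[OF this], of z 0] show ?thesis by simp
qed

lemma pos_strict_mono: "strict_mono pos"
  by (rule strict_monoI, rule DERIV_pos_imp_increasing) (use DERIV_pos speed_pos in blast)+

text \<open>The chord slope is bounded above on [0, 1], so \<open>speed\<close> is bounded below and
  \<open>pos\<close> grows at least linearly; oddness gives the negative values.\<close>

lemma pos_surj: "surj pos"
proof -
  have "continuous_on {0..1} (chord_slope (p - 2))" using p by (intro continuous_on_chord_slope) auto
  then obtain B where B: "\<And>t. t \<in> {0..1} \<Longrightarrow> \<bar>chord_slope (p - 2) t\<bar> \<le> B"
    using continuous_on_Icc_abs_bounded by blast
  define \<delta> where "\<delta> = 2 * sqrt m / (sqrt c * sqrt B)"
  have "B > 0" using B[of 0] p by (simp add: chord_slope_def)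
  then have \<delta>: "\<delta> > 0" using m c_pos by (simp add: \<delta>_def)
  have "speed z \<ge> \<delta>" for z
  proof -
    have "chord_slope (p - 2) (min 1 (z\<^sup>2)) \<le> B" using B[of "min 1 (z\<^sup>2)"] by auto
    then show ?thesis unfolding speed_def \<delta>_def
      using m c_pos slope_pos[of z] by (intro divide_left_mono mult_left_mono) (auto intro!: mult_pos_pos simp: \<open>B > 0\<close>)
  qed
  then have lin: "pos z \<ge> \<delta> * z" if "z \<ge> 0" for z
  proof (cases "z = 0")
    case False
    then have "0 < z" using that by simp
    then obtain y where "pos z - pos 0 = (z - 0) * speed y"
      using MVT2[of 0 z pos speed] DERIV_pos by blast
    then show ?thesis
      using mult_right_mono[OF \<open>\<And>z. speed z \<ge> \<delta>\<close>[of y] that] by (simp add: mult.commute)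
  qed simp
  have cont: "continuous_on {a..b} pos" for a b
    by (rule DERIV_continuous_on) (rule has_field_derivative_at_within[OF DERIV_pos])
  have "\<exists>z. pos z = x" if "x \<ge> 0" for x
  proof -
    have "x \<le> pos (x / \<delta>)" using lin[of "x/\<delta>"] that \<delta> by simp
    then show ?thesis using IVT'[of pos 0 x "x/\<delta>"] that \<delta> cont by auto
  qed
  then have "\<exists>z. pos z = x" for x
    by (metis pos_minus minus_minus linear neg_0_le_iff_le)
  then show ?thesis by (metis surjI surj_def)
qed

definition par :: "real \<Rightarrow> real" where "par = inv pos"

lemma pos_par [simp]: "pos (par x) = x" and par_pos [simp]: "par (pos z) = z"
  using pos_surj strict_mono_imp_inj_on[OF pos_strict_mono] by (auto simp: par_def surj_f_inv_f)

lemma pos_less_iff: "pos x < pos y \<longleftrightarrow> x < y"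
  using pos_strict_mono by (rule strict_mono_less)

lemma par_less_iff: "par x < par y \<longleftrightarrow> x < y"
  using pos_less_iff[of "par x" "par y"] by simp

lemma par_le_iff: "par x \<le> par y \<longleftrightarrow> x \<le> y"
  using par_less_iff[of y x] by linarith

lemma par_0 [simp]: "par 0 = 0" using par_pos[of 0] by simp

lemma par_minus: "par (- x) = - par x"
  using par_pos[of "- par x"] by (simp add: pos_minus)

lemma par_cont: "continuous_on S par"
proof -
  have "par ` UNIV = UNIV" using par_pos by (metis surjI)
  then have "continuous_on UNIV par"
    by (intro continuous_onI_mono) (auto simp: par_le_iff)
  then show ?thesis by (rule continuous_on_subset) simp
qed

lemma DERIV_par: "(par has_real_derivative inverse (speed (par x))) (at x)"
proof (rule DERIV_inverse_function[where f=pos and a="x-1" and b="x+1"])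
  show "(pos has_real_derivative speed (par x)) (at (par x))" by (rule DERIV_pos)
  show "speed (par x) \<noteq> 0" using speed_pos[of "par x"] by simp
  show "isCont par x" using par_cont[of UNIV] by (simp add: continuous_on_eq_continuous_at)
qed auto

definition radius :: real where "radius = pos 1"

lemma radius_pos: "radius > 0"
  using pos_less_iff[of 0 1] by (simp add: radius_def)

lemma par_radius: "par radius = 1" by (simp add: radius_def)

lemma par_sq_less_1: "(par x)\<^sup>2 < 1 \<longleftrightarrow> \<bar>x\<bar> < radius"
proof -
  have "(par x)\<^sup>2 < 1 \<longleftrightarrow> par (- radius) < par x \<and> par x < par radius"
    by (auto simp: abs_square_less_1 par_minus par_radius abs_less_iff)
  also have "\<dots> \<longleftrightarrow> \<bar>x\<bar> < radius" unfolding par_less_iff by auto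
  finally show ?thesis .
qed

definition \<phi> :: "real \<Rightarrow> real" where
  "\<phi> x = sqrt m * max 0 (1 - (par x)\<^sup>2)"

text \<open>The derivative of \<phi> inside the support. The formula continues past the edge as a
  continuous function, which makes \<phi> \<phi>' continuous on the line.\<close>

definition \<phi>' :: "real \<Rightarrow> real" where
  "\<phi>' x = - sqrt c * par x * sqrt (chord_slope (p - 2) (min 1 ((par x)\<^sup>2)))"

lemma inverse_speed: "sqrt m * (- (2 * par x * inverse (speed (par x)))) = \<phi>' x"
  using m by (simp add: speed_def \<phi>'_def)

lemma \<phi>_cont: "continuous_on S \<phi>" unfolding \<phi>_def by (intro continuous_intros par_cont)

lemma \<phi>'_cont: "continuous_on S \<phi>'" unfolding \<phi>'_def by (intro continuous_intros par_cont slope_cont)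

lemma \<phi>_nonneg: "\<phi> x \<ge> 0" using m by (simp add: \<phi>_def)

lemma \<phi>_pos_iff: "\<phi> x > 0 \<longleftrightarrow> \<bar>x\<bar> < radius"
  using m by (simp add: \<phi>_def zero_less_mult_iff max_def par_sq_less_1[symmetric])

lemma \<phi>_eq_0_iff: "\<phi> x = 0 \<longleftrightarrow> radius \<le> \<bar>x\<bar>"
  using \<phi>_pos_iff[of x] \<phi>_nonneg[of x] by linarith

lemma \<phi>_minus: "\<phi> (- x) = \<phi> x" by (simp add: \<phi>_def par_minus)

lemma \<phi>_0: "\<phi> 0 = sqrt m" by (simp add: \<phi>_def)

lemma \<phi>_le: "\<phi> x \<le> sqrt m" using m by (simp add: \<phi>_def mult_left_le)

lemma \<phi>_decreasing: assumes "0 \<le> x" "x < y" "y \<le> radius" shows "\<phi> y < \<phi> x"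
proof -
  have "0 \<le> par x" "par x < par y" "par y \<le> 1"
    using assms par_le_iff[of 0 x] par_less_iff[of x y] par_le_iff[of y radius] by (simp_all add: par_radius)
  then have "(par x)\<^sup>2 < (par y)\<^sup>2" "(par y)\<^sup>2 \<le> 1"
    by (auto intro: power_strict_mono simp: abs_square_le_1)
  then show ?thesis using m by (simp add: \<phi>_def)
qed

lemma \<phi>_antimono: assumes "0 \<le> x" "x \<le> y" shows "\<phi> y \<le> \<phi> x"
  using \<phi>_decreasing[of x y] assms \<phi>_eq_0_iff[of y] \<phi>_nonneg[of x] by (cases "x = y"; cases "y \<le> radius") auto

lemma DERIV_\<phi>:
  assumes "\<bar>x\<bar> < radius"
  shows "(\<phi> has_real_derivative \<phi>' x) (at x)"
proof -
  have D: "((\<lambda>x. sqrt m * (1 - (par x)\<^sup>2)) has_real_derivative sqrt m * (- (2 * par x * inverse (speed (par x))))) (at x)"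
    by (auto intro!: derivative_eq_intros DERIV_par)
  have E: "sqrt m * (1 - (par y)\<^sup>2) = \<phi> y" if "y \<in> {-radius<..<radius}" for y
  proof -
    have "(par y)\<^sup>2 < 1" using that by (subst par_sq_less_1) auto
    then show ?thesis by (simp add: \<phi>_def)
  qed
  show ?thesis
    by (rule has_field_derivative_transform_within_open[where S="{-radius<..<radius}", OF D[unfolded inverse_speed]])
       (use assms E in auto)
qed

lemma DERIV_\<phi>_sq: "((\<lambda>x. (\<phi> x)\<^sup>2) has_real_derivative 2 * \<phi> x * \<phi>' x) (at x)"
proof -
  have "((\<lambda>x. (max 0 (1 - (par x)\<^sup>2))\<^sup>2) has_real_derivative
      2 * max 0 (1 - (par x)\<^sup>2) * (- (2 * par x * inverse (speed (par x))))) (at x)"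
    by (rule DERIV_chain2[OF DERIV_max_0_power2]) (auto intro!: derivative_eq_intros DERIV_par)
  then have "((\<lambda>x. (sqrt m)\<^sup>2 * (max 0 (1 - (par x)\<^sup>2))\<^sup>2) has_real_derivative
      (sqrt m)\<^sup>2 * (2 * max 0 (1 - (par x)\<^sup>2) * (- (2 * par x * inverse (speed (par x)))))) (at x)"
    by (rule DERIV_cmult)
  also have "(sqrt m)\<^sup>2 * (2 * max 0 (1 - (par x)\<^sup>2) * (- (2 * par x * inverse (speed (par x))))) = 2 * \<phi> x * \<phi>' x"
    unfolding inverse_speed[symmetric] \<phi>_def power2_eq_square[of "sqrt m"] by (simp only: ac_simps)
  finally show ?thesis by (simp only: \<phi>_def power_mult_distrib)
qed

lemma sqrt_m_powr: "sqrt m powr (p - 2) = p * c / 2"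
proof -
  have "sqrt m powr (p - 2) = m powr (p/2 - 1)"
    using m by (simp add: powr_half_sqrt[symmetric] powr_powr diff_divide_distrib)
  then show ?thesis using p by (simp add: c_def)
qed

text \<open>The first integral with B = 0, divided by \<phi>^2. \<open>chord_slope_mult\<close>
  undoes the factorization, and 1 - z^2 is \<phi> / sqrt m.\<close>

lemma \<phi>'_sq:
  assumes "\<bar>x\<bar> < radius"
  shows "(\<phi>' x)\<^sup>2 = c - 2 / p * \<phi> x powr (p - 2)"
proof -
  have l: "(par x)\<^sup>2 < 1" using assms by (simp add: par_sq_less_1)
  have "(\<phi>' x)\<^sup>2 = c * ((par x)\<^sup>2 * chord_slope (p - 2) ((par x)\<^sup>2))"
    using l c_pos slope_pos[of "par x"] by (simp add: \<phi>'_def power_mult_distrib min_def)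
  also have "\<dots> = c - c * (1 - (par x)\<^sup>2) powr (p - 2)" unfolding chord_slope_mult by (simp add: algebra_simps)
  also have "c * (1 - (par x)\<^sup>2) powr (p - 2) = 2 / p * \<phi> x powr (p - 2)"
  proof -
    have "\<phi> x powr (p - 2) = (p * c / 2) * (1 - (par x)\<^sup>2) powr (p - 2)"
      using l m by (simp add: \<phi>_def powr_mult sqrt_m_powr)
    then show ?thesis using p by (simp add: field_simps)
  qed
  finally show ?thesis .
qed

lemma DERIV_\<phi>_powr:
  assumes "\<bar>x\<bar> < radius"
  shows "((\<lambda>x. \<phi> x powr k) has_real_derivative k * \<phi> x powr (k - 1) * \<phi>' x) (at x)"
proof -
  have \<phi>p: "\<phi> x > 0" using assms by (simp add: \<phi>_pos_iff)
  show ?thesis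
    using DERIV_powr[OF DERIV_\<phi>[OF assms] \<phi>p DERIV_const, of k] \<phi>p by (simp add: powr_diff field_simps)
qed

text \<open>Away from 0 the function \<phi>' is, up to a constant sign, the square root of c - 2/p
  \<phi>^(p-2) and can be differentiated as such. At 0 this root vanishes, and the derivative is
  read off from the product of \<open>par\<close> with a continuous factor.\<close>

lemma DERIV_\<phi>':
  assumes x: "\<bar>x\<bar> < radius"
  shows "(\<phi>' has_real_derivative - ((p - 2) / p) * \<phi> x powr (p - 3)) (at x)"
proof (cases "x = 0")
  case True
  let ?H = "\<lambda>x. - sqrt c * sqrt (chord_slope (p - 2) (min 1 ((par x)\<^sup>2)))"
  have "continuous_on UNIV ?H" by (intro continuous_intros slope_cont par_cont)
  then have "isCont ?H 0" by (simp add: continuous_on_eq_continuous_at)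
  then have "(?H \<longlongrightarrow> ?H 0) (at 0)" by (simp add: isCont_def)
  moreover have "((\<lambda>h. par h / h) \<longlongrightarrow> inverse (speed 0)) (at 0)"
    using DERIV_par[of 0] by (simp add: DERIV_def)
  ultimately have "((\<lambda>h. par h / h * ?H h) \<longlongrightarrow> inverse (speed 0) * ?H 0) (at 0)"
    by (rule tendsto_mult[rotated])
  then have "(\<phi>' has_real_derivative inverse (speed 0) * ?H 0) (at 0)"
    by (simp add: DERIV_def \<phi>'_def algebra_simps)
  also have "inverse (speed 0) * ?H 0 = - c * (p - 2) / (2 * sqrt m)"
  proof -
    have "sqrt c * sqrt c = c" "sqrt (p - 2) * sqrt (p - 2) = p - 2" using c_pos p by simp_all
    then have "(sqrt c * sqrt (p - 2)) * (sqrt c * sqrt (p - 2)) = c * (p - 2)"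
      by (metis mult.assoc mult.left_commute)
    then show ?thesis using m by (simp add: speed_def chord_slope_def)
  qed
  also have "\<dots> = - ((p - 2) / p) * \<phi> 0 powr (p - 3)"
  proof -
    have "sqrt m powr (p - 3) = sqrt m powr (p - 2) / sqrt m"
      using m powr_diff[of "sqrt m" "p - 2" 1] by simp
    then show ?thesis using p m by (simp add: \<phi>_0 sqrt_m_powr)
  qed
  finally show ?thesis using True by simp
next
  case False
  define \<sigma> where "\<sigma> = sgn x"
  \<comment> \<open>The side of the origin that contains x; \<phi>' has one sign there.\<close>
  let ?S = "if x > 0 then {0<..<radius} else {-radius<..<0}"
  let ?q = "\<lambda>x. c - 2 / p * \<phi> x powr (p - 2)"
  have \<phi>p: "\<phi> x > 0" using x by (simp add: \<phi>_pos_iff)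
  have sgn_\<phi>': "sgn (\<phi>' y) = - sgn y" for y
  proof -
    have "sgn (par y) = sgn y" using par_less_iff[of 0 y] par_less_iff[of y 0] by (auto simp: sgn_if)
    then show ?thesis using c_pos slope_pos[of "par y"] by (simp add: \<phi>'_def sgn_mult)
  qed
  have q0: "\<phi>' x \<noteq> 0" using sgn_\<phi>'[of x] False by (auto simp: sgn_if split: if_splits)
  have rep: "\<phi>' y = - \<sigma> * sqrt (?q y)" if "y \<in> ?S" for y
  proof -
    have y: "\<bar>y\<bar> < radius" "sgn y = \<sigma>" using that False x by (auto simp: \<sigma>_def split: if_splits)
    have "\<phi>' y = sgn (\<phi>' y) * \<bar>\<phi>' y\<bar>" by (simp add: sgn_mult_abs)
    also have "\<bar>\<phi>' y\<bar> = sqrt (?q y)" unfolding \<phi>'_sq[OF y(1), symmetric] by simp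
    finally show ?thesis using sgn_\<phi>'[of y] y by simp
  qed
  have xS: "x \<in> ?S" using x False by auto
  have "(\<phi>' x)\<^sup>2 > 0" using q0 by simp
  then have q: "?q x > 0" "sqrt (?q x) \<noteq> 0" unfolding \<phi>'_sq[OF x] by simp_all
  have "((\<lambda>x. \<phi> x powr (p - 2)) has_real_derivative (p - 2) * \<phi> x powr (p - 3) * \<phi>' x) (at x)"
    using DERIV_\<phi>_powr[OF x, of "p - 2"] by simp
  from DERIV_diff[OF DERIV_const DERIV_cmult[OF this, of "2 / p"], of c]
  have "(?q has_real_derivative - 2 / p * ((p - 2) * \<phi> x powr (p - 3) * \<phi>' x)) (at x)" by simp
  from DERIV_chain2[OF DERIV_real_sqrt[OF q(1)] this]
  have "((\<lambda>x. - \<sigma> * sqrt (?q x)) has_real_derivative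
      - \<sigma> * (inverse (sqrt (?q x)) / 2 * (- 2 / p * ((p - 2) * \<phi> x powr (p - 3) * \<phi>' x)))) (at x)"
    by (rule DERIV_cmult)
  also have "- \<sigma> * (inverse (sqrt (?q x)) / 2 * (- 2 / p * ((p - 2) * \<phi> x powr (p - 3) * \<phi>' x))) =
      - ((p - 2) / p) * \<phi> x powr (p - 3)"
  proof -
    have "\<sigma> * \<sigma> = 1" using False by (simp add: \<sigma>_def sgn_mult_self_eq)
    have E: "- \<sigma> * (inverse r / 2 * (- 2 / p * ((p - 2) * P * (- \<sigma> * r)))) = - (\<sigma> * \<sigma>) * ((p - 2) / p) * P"
      if "r \<noteq> 0" for r P using that p by (simp add: field_simps)
    show ?thesis unfolding rep[OF xS] E[OF q(2)] \<open>\<sigma> * \<sigma> = 1\<close>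
      using p by (simp add: field_simps)
  qed
  finally show ?thesis
    by (rule has_field_derivative_transform_within_open[where S="?S"]) (use xS rep in auto)
qed

lemma potential_\<phi>: "potential p m ((\<phi> x)\<^sup>2) = c / 2 * (\<phi> x)\<^sup>2 - \<phi> x powr p / p"
proof (cases "\<phi> x = 0")
  case False
  then have "\<phi> x > 0" using \<phi>_nonneg[of x] by simp
  then have "((\<phi> x)\<^sup>2) powr (p/2) = \<phi> x powr p" by (simp add: powr_powr flip: powr_numeral)
  then show ?thesis using p by (simp add: potential_def c_def field_simps)
qed simp

lemma \<phi>\<phi>'_sq: "(2 * \<phi> x * \<phi>' x)\<^sup>2 = 8 * potential p m ((\<phi> x)\<^sup>2)"
proof (cases "\<bar>x\<bar> < radius")
  case True
  then have "\<phi> x > 0" by (simp add: \<phi>_pos_iff)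
  then have "(\<phi> x)\<^sup>2 * \<phi> x powr (p - 2) = \<phi> x powr p"
    by (simp add: powr_diff flip: powr_numeral)
  then show ?thesis unfolding potential_\<phi>
    by (simp add: power_mult_distrib \<phi>'_sq[OF True] algebra_simps)
next
  case False
  then have "\<phi> x = 0" by (simp add: \<phi>_eq_0_iff)
  then show ?thesis by simp
qed

text \<open>The equality case of the completed square: \<phi>' is opposite in sign to x, which
  selects the right branch of the root on each flank.\<close>

lemma \<phi>\<phi>'_eq: "2 * \<phi> x * \<phi>' x = - sgn x * (sqrt 8 * sqrt (potential p m ((\<phi> x)\<^sup>2)))"
proof -
  have "sgn (par x) = sgn x" using par_less_iff[of 0 x] par_less_iff[of x 0] by (auto simp: sgn_if)
  then have s: "sgn (2 * \<phi> x * \<phi>' x) = - sgn x \<or> 2 * \<phi> x * \<phi>' x = 0"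
    using c_pos slope_pos[of "par x"] \<phi>_nonneg[of x] by (cases "\<phi> x = 0") (auto simp: \<phi>'_def sgn_mult)
  have "\<bar>2 * \<phi> x * \<phi>' x\<bar> = sqrt ((2 * \<phi> x * \<phi>' x)\<^sup>2)" by simp
  also have "\<dots> = sqrt 8 * sqrt (potential p m ((\<phi> x)\<^sup>2))" unfolding \<phi>\<phi>'_sq by (simp add: real_sqrt_mult)
  finally have a: "\<bar>2 * \<phi> x * \<phi>' x\<bar> = sqrt 8 * sqrt (potential p m ((\<phi> x)\<^sup>2))" .
  have "2 * \<phi> x * \<phi>' x = sgn (2 * \<phi> x * \<phi>' x) * \<bar>2 * \<phi> x * \<phi>' x\<bar>" by (simp only: sgn_mult_abs)
  with a s show ?thesis by (metis mult_zero_right sgn_0 abs_0)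
qed

lemma \<phi>_smooth: "smooth_on_open {-radius<..<radius} \<phi>"
proof (rule fun_algebra_smooth[where B="{\<phi>'} \<union> range (\<lambda>k x. \<phi> x powr k)"])
  let ?B = "{\<phi>'} \<union> range (\<lambda>k x. \<phi> x powr k)"
  have b: "(\<lambda>x. \<phi> x powr k) \<in> fun_algebra ?B" "\<phi>' \<in> fun_algebra ?B" for k
    by (rule fun_algebra.base; blast)+
  have "\<phi> = (\<lambda>x. \<phi> x powr 1)" using \<phi>_nonneg by simp
  then show "\<phi> \<in> fun_algebra ?B" using b(1)[of 1] by simp
  fix h assume "h \<in> ?B"
  then consider "h = \<phi>'" | k where "h = (\<lambda>x. \<phi> x powr k)" by blast
  then show "\<exists>h'\<in>fun_algebra ?B. \<forall>x\<in>{-radius<..<radius}. (h has_real_derivative h' x) (at x)"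
  proof cases
    case 1
    have "\<forall>x\<in>{-radius<..<radius}. (h has_real_derivative - ((p - 2) / p) * \<phi> x powr (p - 3)) (at x)"
      unfolding 1 by (intro ballI DERIV_\<phi>') (auto simp: abs_less_iff)
    moreover have "(\<lambda>x. - ((p - 2) / p) * \<phi> x powr (p - 3)) \<in> fun_algebra ?B"
      by (rule fun_algebra.mult[OF fun_algebra.const b(1)])
    ultimately show ?thesis by (rule bexI[where x="\<lambda>x. - ((p - 2) / p) * \<phi> x powr (p - 3)"])
  next
    case 2
    have "\<forall>x\<in>{-radius<..<radius}. (h has_real_derivative k * \<phi> x powr (k - 1) * \<phi>' x) (at x)"
      unfolding 2 by (intro ballI DERIV_\<phi>_powr) (auto simp: abs_less_iff)
    moreover have "(\<lambda>x. k * \<phi> x powr (k - 1) * \<phi>' x) \<in> fun_algebra ?B"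
      by (rule fun_algebra.mult[OF fun_algebra.mult[OF fun_algebra.const b(1)] b(2)])
    ultimately show ?thesis by (rule bexI[where x="\<lambda>x. k * \<phi> x powr (k - 1) * \<phi>' x"])
  qed
qed simp

lemma \<phi>_is_compacton: "is_compacton p 0 c \<phi>"
proof -
  have ode: "- c * \<phi> x + \<phi> x * deriv (\<lambda>y. \<phi> y * deriv \<phi> y) x + \<phi> x powr (p - 1) = 0 \<and>
           - (c / 2) * (\<phi> x)\<^sup>2 + 1/2 * (\<phi> x * deriv \<phi> x)\<^sup>2 + 1/p * \<phi> x powr p = 0"
    if x: "x \<in> {-radius<..<radius}" for x
  proof -
    have ax: "\<bar>x\<bar> < radius" using x by (simp add: abs_less_iff)
    have \<phi>p: "\<phi> x > 0" using ax by (simp add: \<phi>_pos_iff)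
    have d: "deriv \<phi> y = \<phi>' y" if "\<bar>y\<bar> < radius" for y using DERIV_\<phi>[OF that] by (rule DERIV_imp_deriv)
    have "((\<lambda>y. \<phi> y * \<phi>' y) has_real_derivative
        \<phi>' x * \<phi>' x + - ((p - 2) / p) * \<phi> x powr (p - 3) * \<phi> x) (at x)"
      by (rule DERIV_mult[OF DERIV_\<phi>[OF ax] DERIV_\<phi>'[OF ax]])
    then have "((\<lambda>y. \<phi> y * deriv \<phi> y) has_real_derivative
        \<phi>' x * \<phi>' x + - ((p - 2) / p) * \<phi> x powr (p - 3) * \<phi> x) (at x)"
      by (rule has_field_derivative_transform_within_open[where S="{-radius<..<radius}"])
        (use x d in \<open>auto simp: abs_less_iff\<close>)
    then have "deriv (\<lambda>y. \<phi> y * deriv \<phi> y) x = (\<phi>' x)\<^sup>2 - ((p - 2) / p) * (\<phi> x powr (p - 3) * \<phi> x)"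
      by (simp add: DERIV_imp_deriv power2_eq_square)
    also have "\<phi> x powr (p - 3) * \<phi> x = \<phi> x powr (p - 2)"
      using \<phi>p powr_add[of "\<phi> x" "p - 3" 1] by simp
    \<comment> \<open>By \<open>\<phi>'_sq\<close> the coefficients 2/p and (p - 2)/p of
      \<phi>^(p-2) add up to 1.\<close>
    finally have dd: "deriv (\<lambda>y. \<phi> y * deriv \<phi> y) x = c - \<phi> x powr (p - 2)"
      using p by (simp add: \<phi>'_sq[OF ax] diff_divide_distrib algebra_simps)
    have 1: "\<phi> x * \<phi> x powr (p - 2) = \<phi> x powr (p - 1)"
      using \<phi>p powr_add[of "\<phi> x" 1 "p - 2"] by simp
    have 2: "(\<phi> x)\<^sup>2 * \<phi> x powr (p - 2) = \<phi> x powr p"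
      using \<phi>p powr_add[of "\<phi> x" 2 "p - 2"] by simp
    show ?thesis
    proof
      show "- c * \<phi> x + \<phi> x * deriv (\<lambda>y. \<phi> y * deriv \<phi> y) x + \<phi> x powr (p - 1) = 0"
        unfolding dd 1[symmetric] by (simp add: algebra_simps)
      show "- (c / 2) * (\<phi> x)\<^sup>2 + 1/2 * (\<phi> x * deriv \<phi> x)\<^sup>2 + 1/p * \<phi> x powr p = 0"
        unfolding d[OF ax] power_mult_distrib \<phi>'_sq[OF ax] 2[symmetric] by (simp add: algebra_simps)
    qed
  qed
  show ?thesis
    unfolding is_compacton_def
  proof (intro conjI exI[of _ radius])
    show "strict_antimono_on {0<..<radius} \<phi>"
      by (rule monotone_onI) (use \<phi>_decreasing in auto)
  qed (use ode \<phi>_cont \<phi>_nonneg \<phi>_minus \<phi>_smooth radius_pos \<phi>_pos_iff \<phi>_eq_0_iff in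
      \<open>auto simp: abs_less_iff abs_le_iff not_less\<close>)
qed

end

section \<open>Weak derivatives of C1 functions, and the energy of admissible functions\<close>

lemma test_function_C1:
  assumes "test_function \<eta>"
  shows "(\<eta> has_real_derivative deriv \<eta> x) (at x)" "continuous_on UNIV (deriv \<eta>)"
proof -
  have d: "((deriv ^^ n) \<eta>) differentiable (at x)" for n x
    using assms by (auto simp: test_function_def smooth_on_open_def)
  show "(\<eta> has_real_derivative deriv \<eta> x) (at x)"
    using d[of 0 x] by (auto simp: real_differentiable_def DERIV_deriv_iff_real_differentiable)
  show "continuous_on UNIV (deriv \<eta>)"
    using d[of 1] by (auto intro!: differentiable_imp_continuous_on simp: differentiable_on_def differentiable_at_withinI)
qed

text \<open>Integration by parts over an interval that contains the support of the test function, so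
  that the boundary terms vanish.\<close>

lemma C1_has_weak_deriv:
  assumes f: "\<And>x. (f has_real_derivative f' x) (at x)" and f': "continuous_on UNIV f'"
  shows "has_weak_deriv f f'"
proof -
  have fc: "continuous_on UNIV f" using f by (intro DERIV_continuous_on) (auto intro: has_field_derivative_at_within)
  have loc: "locally_integrable h" if "continuous_on UNIV h" for h
    unfolding locally_integrable_def set_integrable_def
    by (intro allI borel_integrable_compact continuous_on_subset[OF that]) auto
  have "(LINT x|lborel. f x * deriv \<eta> x) = - (LINT x|lborel. f' x * \<eta> x)" if \<eta>: "test_function \<eta>" for \<eta>
  proof -
    note \<eta>' = test_function_C1[OF \<eta>]
    have "bounded {x. \<eta> x \<noteq> 0}"
      using \<eta> by (auto simp: test_function_def dest: compact_imp_bounded intro: bounded_subset closure_subset)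
    then obtain N where N: "N > 0" "\<And>x. \<eta> x \<noteq> 0 \<Longrightarrow> \<bar>x\<bar> < N"
      unfolding bounded_pos_less by auto
    have \<eta>0: "\<eta> x = 0" if "\<bar>x\<bar> \<ge> N" for x using N(2)[of x] that by linarith
    have d0: "deriv \<eta> x = 0" if "x \<notin> {-(N+1)..N+1}" for x
    proof -
      have "(\<eta> has_real_derivative 0) (at x)"
        by (rule has_field_derivative_transform_within_open[where f="\<lambda>x. 0" and S="- {-N..N}"])
          (use that \<eta>0 in \<open>auto simp: abs_le_iff not_le\<close>)
      then show ?thesis by (rule DERIV_imp_deriv)
    qed
    have cont: "isCont f' x" "isCont (deriv \<eta>) x" for x
      using f' \<eta>'(2) by (auto simp: continuous_on_eq_continuous_at)
    have "(LINT x|lborel. (f x * deriv \<eta> x) * indicator {-(N+1)..N+1} x) =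
        f (N+1) * \<eta> (N+1) - f (-(N+1)) * \<eta> (-(N+1)) - (LINT x|lborel. (f' x * \<eta> x) * indicator {-(N+1)..N+1} x)"
      by (rule integral_by_parts) (use N(1) f \<eta>'(1) cont in auto)
    moreover have "(\<lambda>x. (f x * deriv \<eta> x) * indicator {-(N+1)..N+1} x) = (\<lambda>x. f x * deriv \<eta> x)"
    proof
      show "(f x * deriv \<eta> x) * indicator {-(N+1)..N+1} x = f x * deriv \<eta> x" for x
        using d0[of x] by (cases "x \<in> {-(N+1)..N+1}") auto
    qed
    moreover have "(\<lambda>x. (f' x * \<eta> x) * indicator {-(N+1)..N+1} x) = (\<lambda>x. f' x * \<eta> x)"
    proof
      show "(f' x * \<eta> x) * indicator {-(N+1)..N+1} x = f' x * \<eta> x" for x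
        using \<eta>0[of x] N(1) by (cases "x \<in> {-(N+1)..N+1}") auto
    qed
    moreover have "\<eta> (N+1) = 0" "\<eta> (-(N+1)) = 0" using \<eta>0 N(1) by auto
    ultimately show ?thesis by (simp only: mult_zero_right diff_self diff_0)
  qed
  then show ?thesis using loc fc f' by (auto simp: has_weak_deriv_def)
qed

lemma continuous_compact_support_integrable:
  fixes h :: "real \<Rightarrow> real"
  assumes "continuous_on UNIV h" "\<And>x. x \<notin> {a..b} \<Longrightarrow> h x = 0"
  shows "integrable lborel h" "(LINT x|lborel. h x) = integral {a..b} h"
proof -
  have 1: "set_integrable lborel {a..b} h"
    unfolding set_integrable_def by (intro borel_integrable_compact continuous_on_subset[OF assms(1)]) auto
  have 2: "(\<lambda>x. indicator {a..b} x *\<^sub>R h x) = h" using assms(2) by (auto simp: indicator_def fun_eq_iff)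
  show "integrable lborel h" using 1 2 by (simp add: set_integrable_def)
  show "(LINT x|lborel. h x) = integral {a..b} h"
    using set_borel_integral_eq_integral(2)[OF 1] 2 by (simp add: set_lebesgue_integral_def)
qed

lemma weak_deriv_is_weak_deriv: "has_weak_deriv f g \<Longrightarrow> has_weak_deriv f (weak_deriv f)"
  unfolding weak_deriv_def by (rule someI[where P="has_weak_deriv f"])

text \<open>Admissibility supplies some square integrable weak derivative. The one chosen by
  \<open>weak_deriv\<close> may be another, but it agrees with it almost everywhere and so is square
  integrable too.\<close>

lemma admissible_finite_energy:
  assumes "admissible u"
  shows "finite_energy (\<lambda>x. (u x)\<^sup>2) (weak_deriv (\<lambda>x. (u x)\<^sup>2))"
proof -
  let ?w = "\<lambda>x. (u x)\<^sup>2"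
  have u: "continuous_on UNIV u" "in_L2 u" "in_H1 ?w" using assms by (auto simp: admissible_def)
  then obtain g where g: "has_weak_deriv ?w g" "in_L2 g" by (auto simp: in_H1_def)
  have w: "continuous_on UNIV ?w" using u by (intro continuous_intros)
  have wd: "has_weak_deriv ?w (weak_deriv ?w)" by (rule weak_deriv_is_weak_deriv[OF g(1)])
  have meas: "weak_deriv ?w \<in> borel_measurable borel"
    using wd by (intro locally_integrable_measurable) (simp add: has_weak_deriv_def)
  have ae: "AE x in lborel. g x = weak_deriv ?w x" by (rule weak_deriv_AE_unique[OF w g(1) wd])
  show ?thesis
  proof
    show "integrable lborel (\<lambda>x. (weak_deriv ?w x)\<^sup>2)"
    proof (rule integrable_cong_AE_imp)
      show "integrable lborel (\<lambda>x. (g x)\<^sup>2)" using g(2) by (simp add: in_L2_def)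
      show "(\<lambda>x. (weak_deriv ?w x)\<^sup>2) \<in> borel_measurable lborel" using meas by simp
      show "AE x in lborel. (g x)\<^sup>2 = (weak_deriv ?w x)\<^sup>2" using ae by eventually_elim simp
    qed
  qed (use u w meas weak_deriv_continuous_increment[OF w wd] in \<open>auto simp: in_L2_def in_H1_def\<close>)
qed

lemma hamiltonian_eq:
  "hamiltonian p u = (LINT x|lborel. (weak_deriv (\<lambda>x. (u x)\<^sup>2) x)\<^sup>2) / 8 - (LINT x|lborel. ((u x)\<^sup>2) powr (p/2)) / p"
proof -
  have 1: "((u x)\<^sup>2) powr (p/2) = \<bar>u x\<bar> powr p" for x
  proof -
    have "(u x)\<^sup>2 = \<bar>u x\<bar> powr 2" by simp
    then show ?thesis by (simp only: powr_powr) simp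
  qed
  have 2: "\<bar>u_ux u x\<bar>\<^sup>2 = (weak_deriv (\<lambda>x. (u x)\<^sup>2) x)\<^sup>2 / 4" for x
    by (simp add: u_ux_def power2_eq_square)
  show ?thesis unfolding hamiltonian_def 1 2 by simp
qed

lemma mass_eq: "mass u = (LINT x|lborel. (u x)\<^sup>2)" by (simp add: mass_def)

section \<open>Energy and mass of the profile\<close>

context profile
begin

abbreviation "W x \<equiv> (\<phi> x)\<^sup>2"

abbreviation "W' x \<equiv> 2 * \<phi> x * \<phi>' x"

lemma W_weak_deriv: "has_weak_deriv (\<lambda>x. W (x - a)) (\<lambda>x. W' (x - a))"
proof (rule C1_has_weak_deriv)
  show "((\<lambda>x. W (x - a)) has_real_derivative W' (x - a)) (at x)" for x
    using DERIV_\<phi>_sq[of "x - a"] DERIV_shift[of W "W' (x - a)" x "- a"] by simp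
  show "continuous_on UNIV (\<lambda>x. W' (x - a))"
    by (intro continuous_intros continuous_on_compose2[OF \<phi>_cont[of UNIV]] continuous_on_compose2[OF \<phi>'_cont[of UNIV]]) auto
qed

context
  fixes u :: "real \<Rightarrow> real" and a :: real
  assumes u_cont: "continuous_on UNIV u" and u_sq: "\<And>x. (u x)\<^sup>2 = W (x - a)"
begin

lemma u_outside: "x \<notin> {a - radius..a + radius} \<Longrightarrow> \<phi> (x - a) = 0"
  by (auto simp: \<phi>_eq_0_iff abs_if)

lemma profile_admissible: "admissible u"
proof -
  have c1: "continuous_on UNIV (\<lambda>x. \<phi> (x - a))" "continuous_on UNIV (\<lambda>x. \<phi>' (x - a))"
    by (intro continuous_on_compose2[OF \<phi>_cont[of UNIV]] continuous_on_compose2[OF \<phi>'_cont[of UNIV]] continuous_intros; simp)+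
  have L2: "in_L2 h" if "continuous_on UNIV h" "\<And>x. x \<notin> {a - radius..a + radius} \<Longrightarrow> h x = 0" for h
    unfolding in_L2_def
  proof
    show "h \<in> borel_measurable lborel" using borel_measurable_continuous_onI[OF that(1)] by simp
    show "integrable lborel (\<lambda>x. (h x)\<^sup>2)"
      by (rule continuous_compact_support_integrable(1)[of _ "a - radius" "a + radius"])
        (use that in \<open>auto intro!: continuous_intros\<close>)
  qed
  have "in_L2 u"
  proof (rule L2[OF u_cont])
    fix x assume "x \<notin> {a - radius..a + radius}"
    then have "\<phi> (x - a) = 0" by (rule u_outside)
    then have "(u x)\<^sup>2 = 0" by (simp add: u_sq)
    then show "u x = 0" by simp
  qed
  moreover have "in_L2 (\<lambda>x. W (x - a))"
    by (rule L2, intro continuous_intros c1, subst u_outside, assumption, simp)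
  moreover have "in_L2 (\<lambda>x. W' (x - a))"
    by (rule L2, intro continuous_intros c1, subst u_outside, assumption, simp)
  ultimately show ?thesis using u_cont W_weak_deriv[of a] by (auto simp: admissible_def in_H1_def u_sq)
qed

text \<open>By \<open>\<phi>\<phi>'_eq\<close> the defect vanishes almost everywhere, so only the
  other terms of the energy identity remain. Speaking of the square of u treats both signs and all
  translates at once.\<close>

lemma profile_hamiltonian:
  "hamiltonian p u = 2 * unit_action p * m powr (1 + p/4) - m powr (p/2 - 1) / p * mass u"
proof -
  let ?w = "\<lambda>x. (u x)\<^sup>2"
  let ?g = "weak_deriv ?w"
  interpret finite_energy ?w ?g by (rule admissible_finite_energy[OF profile_admissible])
  interpret bounded_energy ?w ?g p m a
  proof
    show "(u x)\<^sup>2 \<le> m" for x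
      unfolding u_sq using power_mono[OF \<phi>_le[of "x - a"] \<phi>_nonneg, of 2] m by simp
    show "(u a)\<^sup>2 = m" using m by (simp add: u_sq \<phi>_0)
  qed (rule p m)+
  have wd: "has_weak_deriv ?w ?g"
    by (rule weak_deriv_is_weak_deriv[of _ "\<lambda>x. W' (x - a)"]) (simp only: u_sq W_weak_deriv)
  have "AE x in lborel. ?g x = W' (x - a)"
    by (rule weak_deriv_AE_unique[OF w_cont wd]) (simp only: u_sq W_weak_deriv)
  moreover have "AE x in lborel. x \<noteq> a" by (rule AE_lborel_singleton)
  ultimately have "AE x in lborel. defect x = 0"
  proof eventually_elim
    case (elim x)
    have "W' (x - a) = - sgn (x - a) * (sqrt 8 * sqrt (potential p m (?w x)))"
      unfolding \<phi>\<phi>'_eq u_sq ..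
    then show ?case using elim by (auto simp: defect_def sgn_if)
  qed
  then have "(LINT x|lborel. defect x) = 0" by (rule integral_eq_zero_AE)
  then show ?thesis using energy_identity(2) by (simp add: hamiltonian_eq mass_eq)
qed

end

text \<open>The first identity integrates \<open>\<phi>\<phi>'_sq\<close>. The second is the
  Pohozaev identity of the overview: inside the support \<phi>^3 \<phi>' has the derivative 3 c
  \<phi>^2 - (p + 4)/p \<phi>^p, and it vanishes at both edges.\<close>

lemma W_integrals:
  shows "(LINT x|lborel. (W' x)\<^sup>2) = 4 * c * (LINT x|lborel. W x) - 8 / p * (LINT x|lborel. \<phi> x powr p)"
    and "3 * c * (LINT x|lborel. W x) = (p + 4) / p * (LINT x|lborel. \<phi> x powr p)"
proof -
  have out: "\<phi> x = 0" if "x \<notin> {- radius..radius}" for x using that by (auto simp: \<phi>_eq_0_iff abs_if)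
  have i: "integrable lborel (\<lambda>x. W x)" "integrable lborel (\<lambda>x. \<phi> x powr p)"
    by (rule continuous_compact_support_integrable(1)[of _ "- radius" "radius"];
        use out \<phi>_nonneg p in \<open>auto intro!: continuous_intros \<phi>_cont continuous_on_powr'\<close>)+
  have "(W' x)\<^sup>2 = 4 * c * W x - 8 / p * \<phi> x powr p" for x
    unfolding \<phi>\<phi>'_sq potential_\<phi> by simp
  then show "(LINT x|lborel. (W' x)\<^sup>2) = 4 * c * (LINT x|lborel. W x) - 8 / p * (LINT x|lborel. \<phi> x powr p)"
    using i by simp
  let ?h = "\<lambda>x. 3 * c * W x - (p + 4) / p * \<phi> x powr p"
  have "(?h has_integral (\<phi> radius ^ 3 * \<phi>' radius - \<phi> (-radius) ^ 3 * \<phi>' (- radius))) {-radius..radius}"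
  \<comment> \<open>Derivatives are taken in the open support only: for p < 3 the factor
    \<phi>^(p-3) in the derivative of \<phi>' blows up at the edge.\<close>
  proof (rule fundamental_theorem_of_calculus_interior)
    show "continuous_on {- radius..radius} (\<lambda>x. \<phi> x ^ 3 * \<phi>' x)" by (intro continuous_intros \<phi>_cont \<phi>'_cont)
    fix x assume "x \<in> {- radius<..<radius}"
    then have x: "\<bar>x\<bar> < radius" by (simp add: abs_less_iff)
    then have \<phi>p: "\<phi> x > 0" by (simp add: \<phi>_pos_iff)
    have "((\<lambda>x. \<phi> x ^ 3 * \<phi>' x) has_real_derivative
        (3 * (\<phi> x)\<^sup>2 * \<phi>' x) * \<phi>' x + (- ((p - 2) / p) * \<phi> x powr (p - 3)) * \<phi> x ^ 3) (at x)"
      by (rule DERIV_mult[OF _ DERIV_\<phi>'[OF x]]) (use DERIV_power[OF DERIV_\<phi>[OF x], of 3] in \<open>simp add: algebra_simps\<close>)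
    also have "(3 * (\<phi> x)\<^sup>2 * \<phi>' x) * \<phi>' x + (- ((p - 2) / p) * \<phi> x powr (p - 3)) * \<phi> x ^ 3
       = 3 * (\<phi> x)\<^sup>2 * (\<phi>' x)\<^sup>2 - (p - 2) / p * (\<phi> x powr (p - 3) * \<phi> x ^ 3)"
      by (simp add: power2_eq_square)
    also have "\<phi> x powr (p - 3) * \<phi> x ^ 3 = \<phi> x powr p"
      using \<phi>p powr_add[of "\<phi> x" "p - 3" 3] by simp
    also have "3 * (\<phi> x)\<^sup>2 * (\<phi>' x)\<^sup>2 = 3 * c * W x - 6 / p * ((\<phi> x)\<^sup>2 * \<phi> x powr (p - 2))"
      unfolding \<phi>'_sq[OF x] by (simp add: algebra_simps)
    also have "(\<phi> x)\<^sup>2 * \<phi> x powr (p - 2) = \<phi> x powr p"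
      using \<phi>p powr_add[of "\<phi> x" 2 "p - 2"] by simp
    also have "3 * c * W x - 6 / p * \<phi> x powr p - (p - 2) / p * \<phi> x powr p = ?h x"
      by (simp add: add_divide_distrib diff_divide_distrib algebra_simps)
    finally show "((\<lambda>x. \<phi> x ^ 3 * \<phi>' x) has_vector_derivative ?h x) (at x)"
      by (simp add: has_real_derivative_iff_has_vector_derivative)
  qed (use radius_pos in simp)
  moreover have "\<phi> radius = 0" "\<phi> (- radius) = 0" using radius_pos by (simp_all add: \<phi>_eq_0_iff)
  ultimately have "integral {-radius..radius} ?h = 0" by (simp add: integral_unique)
  moreover have "(LINT x|lborel. ?h x) = integral {-radius..radius} ?h"
    by (rule continuous_compact_support_integrable(2))
      (use out \<phi>_nonneg p in \<open>auto intro!: continuous_intros \<phi>_cont continuous_on_powr'\<close>)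
  ultimately show "3 * c * (LINT x|lborel. W x) = (p + 4) / p * (LINT x|lborel. \<phi> x powr p)" using i by simp
qed

text \<open>The energy of \<phi> is computed from \<open>profile_hamiltonian\<close> and again from
  \<open>W_integrals\<close>, and the integral of \<phi>^p is eliminated. The resulting relation
  between peak and mass is the stationarity condition in \<open>profile_energy_le\<close>.\<close>

lemma mass_profile: "(p - 2) * c * mass \<phi> = 2 * (p + 4) * unit_action p * m powr (1 + p/4)"
proof -
  let ?w = "\<lambda>x. (\<phi> x)\<^sup>2"
  have H: "hamiltonian p \<phi> = 2 * unit_action p * m powr (1 + p/4) - m powr (p/2 - 1) / p * mass \<phi>"
    by (rule profile_hamiltonian[of _ 0]) (auto simp: \<phi>_cont)
  have wd: "has_weak_deriv ?w W'" using W_weak_deriv[of 0] by simp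
  have wd': "has_weak_deriv ?w (weak_deriv ?w)" by (rule weak_deriv_is_weak_deriv[OF wd])
  have ae: "AE x in lborel. weak_deriv ?w x = W' x"
    by (rule weak_deriv_AE_unique[OF _ wd' wd]) (intro continuous_intros \<phi>_cont)
  have "(LINT x|lborel. (weak_deriv ?w x)\<^sup>2) = (LINT x|lborel. (W' x)\<^sup>2)"
  proof (rule integral_cong_AE)
    from ae show "AE x in lborel. (weak_deriv ?w x)\<^sup>2 = (W' x)\<^sup>2" by eventually_elim simp
    have "weak_deriv ?w \<in> borel_measurable borel" "W' \<in> borel_measurable borel"
      using wd wd' by (auto simp: has_weak_deriv_def intro: locally_integrable_measurable)
    then show "(\<lambda>x. (weak_deriv ?w x)\<^sup>2) \<in> borel_measurable lborel" "(\<lambda>x. (W' x)\<^sup>2) \<in> borel_measurable lborel"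
      by (auto intro: borel_measurable_power)
  qed
  moreover have "(?w x) powr (p/2) = \<phi> x powr p" for x
  proof -
    have "?w x = \<phi> x powr 2" using \<phi>_nonneg[of x] by simp
    then show ?thesis by (simp only: powr_powr) simp
  qed
  ultimately have "hamiltonian p \<phi> = (LINT x|lborel. (W' x)\<^sup>2) / 8 - (LINT x|lborel. \<phi> x powr p) / p"
    by (simp add: hamiltonian_eq)
  moreover define I where "I = (LINT x|lborel. \<phi> x powr p) / p"
  moreover have "(LINT x|lborel. (W' x)\<^sup>2) = 4 * (c * mass \<phi>) - 8 * I"
    using W_integrals(1) by (simp add: mass_eq I_def)
  moreover have "hamiltonian p \<phi> = 2 * (unit_action p * m powr (1 + p/4)) - (c * mass \<phi>) / 2"
    using H by (simp add: c_def)
  ultimately have "c * mass \<phi> - 2 * I = 2 * (unit_action p * m powr (1 + p/4))" by linarith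
  moreover have "3 * (c * mass \<phi>) = (p + 4) * I" using W_integrals(2) by (simp add: mass_eq I_def)
  ultimately show ?thesis by algebra
qed

text \<open>The variable z = sqrt (1 - sqrt (w/m)) inverts w = m (1 - z^2)^2, and along the equation
  pos (z y) - y is constant. The strict bounds concern the interior, where both roots are
  differentiable; the ends are reached by continuity.\<close>

lemma ode_unique:
  assumes ax: "a \<le> x" and cont: "continuous_on {a..x} w" and wa: "w a = m" and wx: "0 \<le> w x" "w x \<le> m"
    and ode: "\<And>y. a < y \<Longrightarrow> y < x \<Longrightarrow> 0 < w y \<and> w y < m \<and> (w has_real_derivative - (sqrt 8 * sqrt (potential p m (w y)))) (at y)"
  shows "x - a \<le> radius \<and> w x = W (x - a)"
proof -
  define z where "z y = sqrt (1 - sqrt (w y / m))" for y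
  have z01: "0 \<le> z x" "z x \<le> 1" using wx m by (auto simp: z_def)
  have za: "z a = 0" using wa m by (simp add: z_def)
  have "pos (z x) - x = pos (z a) - a"
  proof (cases "a = x")
    case False
    then have "a < x" using ax by simp
    then show ?thesis
    proof (rule DERIV_isconst_end[where f="\<lambda>y. pos (z y) - y"])
      have pc: "continuous_on UNIV pos"
        by (rule DERIV_continuous_on) (rule has_field_derivative_at_within[OF DERIV_pos])
      have "continuous_on {a..x} z"
        unfolding z_def using m cont by (intro continuous_intros) auto
      then have "continuous_on {a..x} (\<lambda>y. pos (z y))"
        by (rule continuous_on_compose2[OF pc]) simp
      then show "continuous_on {a..x} (\<lambda>y. pos (z y) - y)"
        by (intro continuous_on_diff continuous_on_id)
      fix y assume y: "a < y" "y < x"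
      define s where "s = sqrt (w y / m)"
      define S where "S = sqrt (chord_slope (p - 2) ((z y)\<^sup>2))"
      note o = ode[OF y]
      have s: "0 < s" "s < 1" "s\<^sup>2 = w y / m" using o m by (auto simp: s_def)
      have z: "0 < z y" "z y < 1" "(z y)\<^sup>2 = 1 - s" using s by (auto simp: z_def s_def[symmetric])
      have Sp: "S > 0" unfolding S_def using z s p by (auto intro!: chord_slope_pos)
      have min: "min 1 ((z y)\<^sup>2) = (z y)\<^sup>2" using z s by simp
      have "potential p m (w y) = m * c / 2 * (s\<^sup>2 * (1 - s powr (p - 2)))"
      proof -
        have "potential p m (m * s\<^sup>2) = m powr (p/2) * potential p 1 (s\<^sup>2)"
          using p m by (intro potential_scale) auto
        also have "m powr (p/2) = m * m powr (p/2 - 1)" using m powr_add[of m 1 "p/2 - 1"] by simp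
        also have "(s\<^sup>2) powr (p/2) = s powr p" using s(1) by (simp add: powr_powr flip: powr_numeral)
        then have "potential p 1 (s\<^sup>2) = (s\<^sup>2 * (1 - s powr (p - 2))) / p"
          using s powr_add[of s 2 "p - 2"] by (simp add: potential_def algebra_simps)
        finally show ?thesis using s(3) m p by (simp add: c_def)
      qed
      also have "1 - s powr (p - 2) = (z y)\<^sup>2 * S\<^sup>2"
        using chord_slope_mult[of "(z y)\<^sup>2" "p - 2"] Sp unfolding S_def z(3) by simp
      finally have "sqrt 8 * sqrt (potential p m (w y)) = sqrt (4 * m * c * s\<^sup>2 * ((z y)\<^sup>2 * S\<^sup>2))"
        unfolding real_sqrt_mult[symmetric] by (simp add: algebra_simps)
      also have "\<dots> = 2 * sqrt m * sqrt c * s * z y * S"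
        by (rule real_sqrt_unique) (use s(1) z(1) Sp m c_pos in \<open>simp_all add: power_mult_distrib\<close>)
      finally have w': "(w has_real_derivative - (2 * sqrt m * sqrt c * s * z y * S)) (at y)" using o by simp
      have D1: "((\<lambda>y. w y / m) has_real_derivative - (2 * sqrt m * sqrt c * s * z y * S) / m) (at y)"
        by (rule DERIV_cdivide[OF w'])
      have "((\<lambda>y. sqrt (w y / m)) has_real_derivative inverse s / 2 * (- (2 * sqrt m * sqrt c * s * z y * S) / m)) (at y)"
        using DERIV_chain2[OF DERIV_real_sqrt D1] o m by (simp add: s_def)
      then have D2: "((\<lambda>y. 1 - sqrt (w y / m)) has_real_derivative 0 - inverse s / 2 * (- (2 * sqrt m * sqrt c * s * z y * S) / m)) (at y)"
        by (intro DERIV_diff DERIV_const)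
      have "(z has_real_derivative inverse (z y) / 2 * (0 - inverse s / 2 * (- (2 * sqrt m * sqrt c * s * z y * S) / m))) (at y)"
        using DERIV_chain2[OF DERIV_real_sqrt D2] s by (simp add: z_def[abs_def] s_def)
      from DERIV_chain2[OF DERIV_pos this]
      have "((\<lambda>y. pos (z y)) has_real_derivative speed (z y) * (inverse (z y) / 2 * (0 - inverse s / 2 * (- (2 * sqrt m * sqrt c * s * z y * S) / m)))) (at y)" .
      also have "speed (z y) * (inverse (z y) / 2 * (0 - inverse s / 2 * (- (2 * sqrt m * sqrt c * s * z y * S) / m))) = 1"
        using s(1) z(1) Sp m c_pos unfolding speed_def min S_def[symmetric] by (simp add: field_simps)
      finally show "((\<lambda>y. pos (z y) - y) has_real_derivative 0) (at y)"
        using DERIV_diff[OF _ DERIV_ident] by fastforce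
    qed
  qed simp
  then have eq: "pos (z x) = x - a" using za by simp
  \<comment> \<open>Since z is at most 1, the elapsed length is at most \<open>pos 1\<close>, which
    is \<open>radius\<close>.\<close>
  have "x - a \<le> radius" using z01 pos_less_iff[of 1 "z x"] unfolding eq[symmetric] radius_def by linarith
  moreover have "par (x - a) = z x" unfolding eq[symmetric] by simp
  then have "W (x - a) = m * (max 0 (1 - (z x)\<^sup>2))\<^sup>2" using m by (simp add: \<phi>_def power_mult_distrib)
  moreover have "1 - (z x)\<^sup>2 = sqrt (w x / m)" using wx m by (simp add: z_def)
  ultimately show ?thesis using wx m by simp
qed

end

section \<open>Minimizers\<close>

context profile
begin

lemma potential_nonneg_imp_le:
  assumes s: "0 < s" and pot: "0 \<le> potential p m s"
  shows "s \<le> m"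
proof (rule ccontr)
  assume "\<not> s \<le> m"
  then have "m powr (p/2 - 1) * s < s powr (p/2 - 1) * s"
    using s m p by (intro mult_strict_right_mono powr_less_mono2) auto
  also have "s powr (p/2 - 1) * s = s powr (p/2)" using s powr_add[of s "p/2 - 1" 1] by simp
  finally show False using pot p by (simp add: potential_def zero_le_divide_iff)
qed

text \<open>A solution starting at m may rest there for a while and then follows W with a delay. The
  delay can only raise its values, since W does not increase away from its centre.\<close>

lemma ode_lower:
  assumes cont: "continuous_on {a..} w" and wa: "w a = m" and w: "\<And>x. 0 \<le> w x" "\<And>x. w x \<le> m"
    and ode: "\<And>y. a < y \<Longrightarrow> (w has_real_derivative - (sqrt 8 * sqrt (potential p m (w y)))) (at y)"
    and ax: "a \<le> x"
  shows "W (x - a) \<le> w x"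
proof (cases "w x = m")
  case True
  have "W (x - a) \<le> (sqrt m)\<^sup>2" using \<phi>_le[of "x - a"] \<phi>_nonneg by (intro power_mono) auto
  then show ?thesis using True m by simp
next
  case False
  have anti: "w z \<le> w y" if "a \<le> y" "y \<le> z" for y z
  proof (rule DERIV_nonpos_imp_decreasing_open[OF that(2)])
    show "\<exists>d. (w has_real_derivative d) (at t) \<and> d \<le> 0" if "y < t" "t < z" for t
      using ode[of t] that \<open>a \<le> y\<close> potential_nonneg[OF p w(1) w(2), of t]
      by (intro exI[of _ "- (sqrt 8 * sqrt (potential p m (w t)))"]) auto
    show "continuous_on {y..z} w" by (rule continuous_on_subset[OF cont]) (use that in auto)
  qed
  have sel: "compact {y \<in> {a..b}. w y = l}" for b l
  proof -
    have "continuous_on {a..b} w" by (rule continuous_on_subset[OF cont]) auto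
    then have "closed {y \<in> {a..b}. w y = l}" by (intro continuous_closed_preimage_constant) auto
    moreover have "bounded {y \<in> {a..b}. w y = l}"
      by (rule bounded_subset[OF bounded_closed_interval[of a b]]) auto
    ultimately show ?thesis by (simp add: compact_eq_bounded_closed)
  qed
  \<comment> \<open>The first point at the level w x is used instead of x, because w may have
    reached 0 before x and \<open>ode_unique\<close> requires positive values on the way.\<close>
  obtain t where t: "t \<in> {a..x}" "w t = w x" "\<And>y. y \<in> {a..x} \<Longrightarrow> w y = w x \<Longrightarrow> t \<le> y"
    using compact_attains_inf[OF sel[of x "w x"]] ax by force
  \<comment> \<open>The end of the plateau, where the descent begins.\<close>
  obtain s where s: "s \<in> {a..t}" "w s = m" "\<And>y. y \<in> {a..t} \<Longrightarrow> w y = m \<Longrightarrow> y \<le> s"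
    using compact_attains_sup[OF sel[of t m]] wa t(1) by force
  have "t - s \<le> radius \<and> w t = W (t - s)"
  proof (rule ode_unique)
    show "s \<le> t" using s by simp
    show "continuous_on {s..t} w" by (rule continuous_on_subset[OF cont]) (use s in auto)
    fix y assume y: "s < y" "y < t"
    have "w y \<noteq> w x" using t(3)[of y] y s(1) t(1) by auto
    moreover have "w x \<le> w y" using y s(1) t(1) by (intro anti) auto
    ultimately have "0 < w y" using w(1)[of x] by linarith
    moreover have "w y \<noteq> m" using s(3)[of y] y s(1) by auto
    then have "w y < m" using w(2)[of y] by linarith
    ultimately show "0 < w y \<and> w y < m \<and> (w has_real_derivative - (sqrt 8 * sqrt (potential p m (w y)))) (at y)"
      using ode[of y] y s(1) by auto
  qed (use s w in auto)
  moreover have "\<phi> (x - a) \<le> \<phi> (t - s)" using s t by (intro \<phi>_antimono) auto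
  then have "W (x - a) \<le> W (t - s)" using \<phi>_nonneg by (intro power_mono) auto
  ultimately show ?thesis using t(2) by simp
qed

text \<open>Required because \<open>compacton\<close> is a definite description. Evenness makes the
  slope at 0 vanish, so the first integral forces the square at 0 to be m, the positive zero of the
  potential. Strict decrease excludes a plateau and selects the negative root, and
  \<open>ode_unique\<close> then applies up to the edge.\<close>

lemma compacton_unique:
  assumes \<psi>: "is_compacton p 0 c \<psi>"
  shows "\<psi> = \<phi>"
proof -
  obtain r where r: "r > 0" and out: "\<And>x. x \<notin> {-r<..<r} \<Longrightarrow> \<psi> x = 0"
    and pos: "\<And>x. x \<in> {-r<..<r} \<Longrightarrow> \<psi> x > 0" and sm: "smooth_on_open {-r<..<r} \<psi>"
    and dec: "strict_antimono_on {0<..<r} \<psi>"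
    and first: "\<And>x. x \<in> {-r<..<r} \<Longrightarrow> - (c / 2) * (\<psi> x)\<^sup>2 + 1/2 * (\<psi> x * deriv \<psi> x)\<^sup>2 + 1/p * \<psi> x powr p = 0"
    using \<psi> unfolding is_compacton_def by blast
  have cont: "continuous_on UNIV \<psi>" and nn: "\<And>x. \<psi> x \<ge> 0" and even: "\<And>x. \<psi> (- x) = \<psi> x"
    using \<psi> by (auto simp: is_compacton_def)
  have D: "(\<psi> has_real_derivative deriv \<psi> x) (at x)" if "x \<in> {-r<..<r}" for x
  proof -
    have "((deriv ^^ 0) \<psi>) differentiable (at x)" using sm that unfolding smooth_on_open_def by blast
    then show ?thesis by (simp add: DERIV_deriv_iff_real_differentiable)
  qed
  let ?w = "\<lambda>x. (\<psi> x)\<^sup>2"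
  have sq: "(2 * \<psi> x * deriv \<psi> x)\<^sup>2 = 8 * potential p m (?w x)" if "x \<in> {-r<..<r}" for x
  proof -
    have "?w x powr (p/2) = \<psi> x powr p" using pos[OF that] by (simp add: powr_powr flip: powr_numeral)
    then have "potential p m (?w x) = c / 2 * ?w x - \<psi> x powr p / p"
      using p by (simp add: potential_def c_def field_simps)
    then show ?thesis using first[OF that] by (simp add: power_mult_distrib)
  qed
  have le: "?w x \<le> m" if "x \<in> {-r<..<r}" for x
  proof (rule potential_nonneg_imp_le)
    show "0 < ?w x" using pos[OF that] by simp
    show "0 \<le> potential p m (?w x)" using sq[OF that] zero_le_power2[of "2 * \<psi> x * deriv \<psi> x"] by linarith
  qed
  have d0: "deriv \<psi> 0 = 0"
  proof -
    have "(\<psi> has_real_derivative deriv \<psi> 0) (at (- 0))" using D[of 0] r by simp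
    moreover have "(uminus has_real_derivative (- 1 :: real)) (at 0)" by (auto intro!: derivative_eq_intros)
    ultimately have "((\<lambda>x. \<psi> (- x)) has_real_derivative deriv \<psi> 0 * - 1) (at 0)"
      by (rule DERIV_chain2)
    then have "(\<psi> has_real_derivative - deriv \<psi> 0) (at 0)" by (simp add: even)
    with D[of 0] r have "deriv \<psi> 0 = - deriv \<psi> 0" by (intro DERIV_unique) auto
    then show ?thesis by simp
  qed
  have w0: "?w 0 = m"
  proof (rule antisym)
    show "?w 0 \<le> m" by (rule le) (use r in simp)
    show "m \<le> ?w 0"
    proof (rule ccontr)
      assume "\<not> m \<le> ?w 0"
      then have "potential p m (?w 0) > 0" using pos[of 0] r p by (intro potential_pos) auto
      then show False using sq[of 0] r by (simp add: d0)
    qed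
  qed
  have lt: "?w x < m" if "0 < x" "x < r" for x
  proof -
    \<comment> \<open>The intermediate point x/2, where the square is already known to be at most m,
      makes the bound at x strict.\<close>
    have "\<psi> x < \<psi> (x/2)" using dec that by (auto simp: monotone_on_def)
    then have "?w x < ?w (x/2)" using nn by (intro power_strict_mono) auto
    also have "\<dots> \<le> m" using that by (intro le) auto
    finally show ?thesis .
  qed
  have dneg: "deriv \<psi> x \<le> 0" if "0 < x" "x < r" for x
  proof (rule ccontr)
    assume "\<not> deriv \<psi> x \<le> 0"
    then have "deriv \<psi> x > 0" "x \<in> {-r<..<r}" using that by auto
    then obtain d where d: "d > 0" "\<And>h. 0 < h \<Longrightarrow> h < d \<Longrightarrow> \<psi> x < \<psi> (x + h)"
      using DERIV_pos_inc_right[OF D] by blast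
    define h where "h = min d (r - x) / 2"
    have "0 < h" "h \<le> d / 2" "h \<le> (r - x) / 2" using d(1) that by (auto simp: h_def)
    moreover have "d / 2 < d" "(r - x) / 2 < r - x" using d(1) that by simp_all
    ultimately have h: "0 < h" "h < d" "x + h < r" by linarith+
    then have "\<psi> (x + h) < \<psi> x" using dec that by (auto simp: monotone_on_def)
    then show False using d(2)[OF h(1,2)] by simp
  qed
  have key: "x - 0 \<le> radius \<and> ?w x = W (x - 0)" if "0 \<le> x" "x \<le> r" for x
  proof (rule ode_unique)
    show "continuous_on {0..x} ?w" by (intro continuous_intros continuous_on_subset[OF cont]) auto
    show "?w x \<le> m" using le[of x] out[of x] m that by (cases "x < r") auto
    fix y assume y: "0 < y" "y < x"
    then have yr: "y \<in> {-r<..<r}" using that by auto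
    have "(?w has_real_derivative 2 * \<psi> y * deriv \<psi> y) (at y)"
      using D[OF yr] by (auto intro!: derivative_eq_intros)
    also have "2 * \<psi> y * deriv \<psi> y = - (sqrt 8 * sqrt (potential p m (?w y)))"
    proof -
      have "2 * \<psi> y * deriv \<psi> y \<le> 0" using nn[of y] dneg[of y] y that by (simp add: mult_le_0_iff)
      then have "2 * \<psi> y * deriv \<psi> y = - sqrt ((2 * \<psi> y * deriv \<psi> y)\<^sup>2)" by simp
      then show ?thesis unfolding sq[OF yr] by (simp add: real_sqrt_mult)
    qed
    finally show "0 < ?w y \<and> ?w y < m \<and> (?w has_real_derivative - (sqrt 8 * sqrt (potential p m (?w y)))) (at y)"
      using lt[of y] pos[OF yr] y that by auto
  qed (use that w0 in auto)
  have "r = radius"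
  proof (rule antisym)
    show "r \<le> radius" using key[of r] r by simp
    have "\<phi> r = 0" using key[of r] r out[of r] by simp
    then show "radius \<le> r" using r by (simp add: \<phi>_eq_0_iff)
  qed
  have pos_eq: "\<psi> x = \<phi> x" if "0 \<le> x" for x
  proof (cases "x \<le> r")
    case True
    then have "(\<psi> x)\<^sup>2 = (\<phi> x)\<^sup>2" using key[of x] that by simp
    then show ?thesis using nn[of x] \<phi>_nonneg[of x] by (simp add: power2_eq_iff_nonneg)
  next
    case False
    then show ?thesis using out[of x] \<phi>_eq_0_iff[of x] \<open>r = radius\<close> by auto
  qed
  show ?thesis
  proof
    fix x
    show "\<psi> x = \<phi> x"
      using pos_eq[of x] pos_eq[of "- x"] by (cases "0 \<le> x") (auto simp: even \<phi>_minus)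
  qed
qed

lemma compacton_eq: "compacton p 0 c = \<phi>"
  unfolding compacton_def using \<phi>_is_compacton compacton_unique by (rule the_equality)

text \<open>Within the connected open support a continuous function with this square cannot change
  sign, as it would have to vanish in between; outside, both signs give 0. This reduces the
  classification of minimizers to their squares.\<close>

lemma translate_up_to_sign_iff:
  "translate_up_to_sign u \<phi> \<longleftrightarrow> continuous_on UNIV u \<and> (\<exists>a. \<forall>x. (u x)\<^sup>2 = W (x - a))"
proof
  have c: "continuous_on UNIV (\<lambda>x. \<phi> (x - a))" for a
    by (intro continuous_on_compose2[OF \<phi>_cont[of UNIV]] continuous_intros) auto
  assume "translate_up_to_sign u \<phi>"
  then show "continuous_on UNIV u \<and> (\<exists>a. \<forall>x. (u x)\<^sup>2 = W (x - a))"
    using c by (auto simp: translate_up_to_sign_def intro!: continuous_on_minus)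
next
  have pos: "v = (\<lambda>x. \<phi> (x - a))"
    if v: "continuous_on UNIV v" "\<And>x. (v x)\<^sup>2 = W (x - a)" "v a > 0" for v a
  proof
    fix x
    have pm: "v x = \<phi> (x - a) \<or> v x = - \<phi> (x - a)" using v(2)[of x] by (simp add: power2_eq_iff)
    show "v x = \<phi> (x - a)"
    proof (rule ccontr)
      assume ne: "v x \<noteq> \<phi> (x - a)"
      then have vx: "v x = - \<phi> (x - a)" "\<phi> (x - a) > 0" using pm \<phi>_nonneg[of "x - a"] by auto
      let ?I = "{a - radius<..<a + radius}"
      have "x \<in> ?I" using vx(2) by (auto simp: \<phi>_pos_iff abs_less_iff)
      moreover have "a \<in> ?I" using radius_pos by simp
      moreover have "connected (v ` ?I)"
        by (intro connected_continuous_image continuous_on_subset[OF v(1)]) auto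
      ultimately have "{v x..v a} \<subseteq> v ` ?I" by (intro connected_contains_Icc) auto
      moreover have "0 \<in> {v x..v a}" using vx v(3) by simp
      ultimately obtain y where y: "y \<in> ?I" "v y = 0" by force
      then have "\<phi> (y - a) = 0" using v(2)[of y] by simp
      then show False using y(1) by (auto simp: \<phi>_eq_0_iff abs_if split: if_splits)
    qed
  qed
  assume u: "continuous_on UNIV u \<and> (\<exists>a. \<forall>x. (u x)\<^sup>2 = W (x - a))"
  then obtain a where a: "\<And>x. (u x)\<^sup>2 = W (x - a)" by blast
  have "(u a)\<^sup>2 = m" using m by (simp add: a \<phi>_0)
  then consider "u a > 0" | "- u a > 0" using m by fastforce
  then show "translate_up_to_sign u \<phi>"
  proof cases
    case 1
    then show ?thesis using pos[of u a] u a by (auto simp: translate_up_to_sign_def)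
  next
    case 2
    have "(\<lambda>x. - u x) = (\<lambda>x. \<phi> (x - a))"
      by (rule pos) (use 2 u a in \<open>auto intro: continuous_on_minus\<close>)
    then have "u = (\<lambda>x. - \<phi> (x - a))" by (metis minus_minus)
    then show ?thesis by (auto simp: translate_up_to_sign_def)
  qed
qed

end

section \<open>Functions with zero defect\<close>

context bounded_energy
begin

lemma defect_nonneg: "defect x \<ge> 0" by (simp add: defect_def)

lemma defect_integral_nonneg: "(LINT x|lborel. defect x) \<ge> 0"
  by (simp add: defect_nonneg)

text \<open>Zero defect identifies g almost everywhere with a continuous function of w. Then w is
  the integral of a continuous function and so differentiable in the classical sense.\<close>

lemma ode_right:
  assumes "(LINT x|lborel. defect x) = 0" "x > x0"
  shows "(w has_real_derivative - (sqrt 8 * sqrt (G x))) (at x)"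
proof -
  let ?h = "\<lambda>x. - (sqrt 8 * sqrt (G x))"
  have "AE x in lborel. defect x = 0"
    using assms(1) energy_identity(1) defect_nonneg by (simp add: integral_nonneg_eq_0_iff_AE)
  then have ae: "AE x in lborel. x > x0 \<longrightarrow> g x = ?h x"
    by eventually_elim (auto simp: defect_def field_simps add_eq_0_iff)
  have hc: "continuous_on S ?h" for S by (intro continuous_intros G_cont)
  have eq: "w y = m + integral {x0..y} ?h" if "y \<ge> x0" for y
  proof -
    have [measurable]: "g \<in> borel_measurable borel" by (rule g_meas)
    have "w y - w x0 = (LINT t:{x0..y}|lborel. g t)" by (rule w_incr[OF that])
    also have "\<dots> = (LINT t:{x0..y}|lborel. ?h t)"
      unfolding set_lebesgue_integral_def
    proof (rule integral_cong_AE)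
      show "AE t in lborel. indicator {x0..y} t *\<^sub>R g t = indicator {x0..y} t *\<^sub>R ?h t"
        using ae AE_lborel_singleton[of x0] by eventually_elim (auto simp: indicator_def)
    qed measurable
    also have "\<dots> = integral {x0..y} ?h"
      by (rule set_borel_integral_eq_integral(2))
        (unfold set_integrable_def, intro borel_integrable_compact hc, simp)
    finally show ?thesis by (simp add: w_x0)
  qed
  have "((\<lambda>y. integral {x0..y} ?h) has_real_derivative ?h x) (at x within {x0..x+1})"
    by (rule integral_has_real_derivative) (use assms(2) hc in auto)
  then have "((\<lambda>y. integral {x0..y} ?h) has_real_derivative ?h x) (at x)"
    using assms(2) by (subst (asm) at_within_interior) auto
  then have "((\<lambda>y. m + integral {x0..y} ?h) has_real_derivative ?h x) (at x)"
    using DERIV_add[OF DERIV_const] by fastforce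
  then show ?thesis
    by (rule has_field_derivative_transform_within_open[where S="{x0<..}"]) (use assms(2) eq in auto)
qed

text \<open>\<open>ode_lower\<close>, applied to w and to its reflection, puts the translated
  squared profile below w; as the integrals are equal, the continuous difference is 0.\<close>

lemma defect_0_imp_profile:
  assumes D0: "(LINT x|lborel. defect x) = 0" and mass: "(LINT x|lborel. w x) = mass (profile.\<phi> p m)"
  shows "w x = (profile.\<phi> p m (x - x0))\<^sup>2"
proof -
  interpret profile p m using p m by unfold_locales
  interpret r: bounded_energy "\<lambda>x. w (0 + (-1) * x)" "\<lambda>x. (-1) * g (0 + (-1) * x)" p m "(x0 - 0) * (-1)"
    by (rule bounded_energy_affine) (auto intro: bounded_energy_axioms)
  \<comment> \<open>Under reflection the branches of the defect correspond except at the single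
    point - x0, whence an equality almost everywhere.\<close>
  have "(LINT x|lborel. r.defect x) = (LINT x|lborel. defect (0 + (-1) * x))"
  proof (rule integral_cong_AE)
    show "r.defect \<in> borel_measurable lborel" using r.energy_identity(1) by auto
    show "(\<lambda>x. defect (0 + (-1) * x)) \<in> borel_measurable lborel"
      using lborel_integrable_real_affine[OF energy_identity(1), of "-1" 0] by auto
    have sqm: "(- a - b)\<^sup>2 = (a + b)\<^sup>2" "(- a + b)\<^sup>2 = (a - b)\<^sup>2" for a b :: real
      by (simp_all add: power2_eq_square algebra_simps)
    show "AE x in lborel. r.defect x = defect (0 + (-1) * x)"
      using AE_lborel_singleton[of "- x0"]
    proof eventually_elim
      case (elim x)
      then show ?case unfolding r.defect_def defect_def
        using sqm[of "g (- x) / sqrt 8" "sqrt (G (- x))"] by auto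
    qed
  qed
  also have "\<dots> = 0" using D0 lborel_integral_real_affine[of "-1" defect 0] by simp
  finally have rD0: "(LINT x|lborel. r.defect x) = 0" .
  have lower: "W (x - x0) \<le> w x" for x
  proof (cases "x0 \<le> x")
    case True
    show ?thesis
      by (rule ode_lower[OF _ w_x0 w_nonneg w_le ode_right[OF D0] True]) (rule continuous_on_subset[OF w_cont], simp)
  next
    case False
    have "W (- x - (x0 - 0) * (-1)) \<le> w (0 + (-1) * (- x))"
      by (rule ode_lower[OF _ r.w_x0 r.w_nonneg r.w_le r.ode_right[OF rD0]])
        (use False in \<open>auto intro: continuous_on_subset[OF r.w_cont, simplified]\<close>)
    then show ?thesis using \<phi>_minus[of "x - x0"] by simp
  qed
  have cW: "continuous_on UNIV (\<lambda>x. W (x - x0))"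
    by (intro continuous_intros continuous_on_compose2[OF \<phi>_cont[of UNIV]]) auto
  have iW: "integrable lborel (\<lambda>x. W (x - x0))"
    by (rule continuous_compact_support_integrable(1)[OF cW, of "x0 - radius" "x0 + radius"])
      (auto simp: \<phi>_eq_0_iff abs_if split: if_splits)
  have "(LINT x|lborel. W (x - x0)) = (LINT x|lborel. W x)"
    using lborel_integral_real_affine[of 1 W "- x0"] by simp
  then have tot: "(LINT x|lborel. w x - W (x - x0)) = 0"
    using w_int iW mass by (simp add: mass_eq)
  let ?d = "\<lambda>x. w x - W (x - x0)"
  have dc: "continuous_on S ?d" for S
    by (intro continuous_on_diff continuous_on_subset[OF w_cont] continuous_on_subset[OF cW]) auto
  \<comment> \<open>The nonnegative difference is restricted to a compact interval around x, where
    continuity and a zero integral make it vanish pointwise.\<close>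
  have si: "set_integrable lborel {x-1..x+1} ?d"
    unfolding set_integrable_def by (intro borel_integrable_compact dc) auto
  have "(LINT t:{x-1..x+1}|lborel. ?d t) \<le> (LINT t|lborel. ?d t)"
    unfolding set_lebesgue_integral_def
  proof (rule integral_mono)
    show "integrable lborel (\<lambda>t. indicator {x-1..x+1} t *\<^sub>R ?d t)" using si by (simp add: set_integrable_def)
    show "integrable lborel ?d" using w_int iW by auto
    show "indicator {x-1..x+1} t *\<^sub>R ?d t \<le> ?d t" for t using lower[of t] by (simp add: indicator_def)
  qed
  moreover have "(LINT t:{x-1..x+1}|lborel. ?d t) = integral {x-1..x+1} ?d"
    by (rule set_borel_integral_eq_integral(2)[OF si])
  moreover have "integral {x-1..x+1} ?d \<ge> 0"
    by (rule integral_nonneg) (use lower set_borel_integral_eq_integral(1)[OF si] in auto)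
  ultimately have "integral {x-1..x+1} ?d = 0" using tot by simp
  then have "\<forall>t\<in>{x-1..x+1}. ?d t = 0"
    by (subst (asm) integral_eq_0_iff) (use dc lower in auto)
  then show ?thesis by simp
qed

end

section \<open>Minimization over the height of the peak\<close>

lemma powr_div_diff_min:
  fixes a b y :: real
  assumes ab: "0 < b" "b < a" and y: "0 < y" "y \<noteq> 1"
  shows "1 / a - 1 / b < y powr a / a - y powr b / b"
proof -
  let ?k = "\<lambda>y. y powr a / a - y powr b / b"
  \<comment> \<open>As b < a, this derivative has the sign of t - 1, so 1 is the only minimum
    point.\<close>
  have D: "(?k has_real_derivative t powr (a - 1) - t powr (b - 1)) (at t)" if "t > 0" for t
    using that ab by (auto intro!: derivative_eq_intros)
  consider "y < 1" | "1 < y" using y by linarith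
  then have "?k 1 < ?k y"
  proof cases
    case 1
    have "\<exists>t. y < t \<and> t < 1 \<and> ?k 1 - ?k y = (1 - y) * (t powr (a - 1) - t powr (b - 1))"
      by (rule MVT2[OF 1]) (use D y in auto)
    then obtain t where t: "y < t" "t < 1" "?k 1 - ?k y = (1 - y) * (t powr (a - 1) - t powr (b - 1))" by blast
    have "t powr (a - 1) < t powr (b - 1)" using t y ab by (intro powr_less_mono') auto
    then have "(1 - y) * (t powr (a - 1) - t powr (b - 1)) < 0" using 1 by (intro mult_pos_neg) auto
    with t(3) show ?thesis by simp
  next
    case 2
    have "\<exists>t. 1 < t \<and> t < y \<and> ?k y - ?k 1 = (y - 1) * (t powr (a - 1) - t powr (b - 1))"
      by (rule MVT2[OF 2]) (use D y in auto)
    then obtain t where t: "1 < t" "t < y" "?k y - ?k 1 = (y - 1) * (t powr (a - 1) - t powr (b - 1))" by blast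
    have "t powr (b - 1) < t powr (a - 1)" using t y ab by (intro powr_less_mono) auto
    then have "(y - 1) * (t powr (a - 1) - t powr (b - 1)) > 0" using 2 by (intro mult_pos_pos) auto
    with t(3) show ?thesis by simp
  qed
  then show ?thesis by simp
qed

lemma unit_action_pos:
  assumes "p > 2"
  shows "unit_action p > 0"
proof -
  let ?f = "\<lambda>t. sqrt (potential p 1 t / 2)"
  have c: "continuous_on {0..1} ?f" using assms by (intro continuous_intros) auto
  have nn: "?f t \<ge> 0" if "t \<in> {0..1}" for t using potential_nonneg[OF assms, of t 1] that by simp
  have "integral {0..1} ?f \<noteq> 0"
  proof
    assume "integral {0..1} ?f = 0"
    then have "\<forall>t\<in>{0..1}. ?f t = 0" using integral_eq_0_iff[OF c _ nn] by simp
    from bspec[OF this, of "1/2"] have "?f (1/2) = 0" by simp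
    then show False using potential_pos[OF assms, of "1/2" 1] by simp
  qed
  moreover have "integral {0..1} ?f \<ge> 0" by (rule integral_nonneg) (use c nn integrable_continuous_real in auto)
  ultimately show ?thesis by (simp add: unit_action_def)
qed

text \<open>The integrand is sqrt (t - t^2) / sqrt 8, and the graph of sqrt (t - t^2) is a half
  circle of radius 1/2, enclosing the area pi/8.\<close>

lemma unit_action_4: "unit_action 4 = pi / (16 * sqrt 2)"
proof -
  let ?F = "\<lambda>t. (1 / sqrt 8) * ((2 * t - 1) / 4 * sqrt (t - t\<^sup>2) + arcsin (2 * t - 1) / 8)"
  have "((\<lambda>t. sqrt (potential 4 1 t / 2)) has_integral ?F 1 - ?F 0) {0..1}"
  \<comment> \<open>At both ends of the interval \<open>arcsin\<close> is continuous but not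
    differentiable.\<close>
  proof (rule fundamental_theorem_of_calculus_interior)
    show "continuous_on {0..1} ?F" by (intro continuous_intros) auto
    fix t :: real assume t: "t \<in> {0<..<1}"
    define q where "q = sqrt (t - t\<^sup>2)"
    have tt: "t - t\<^sup>2 > 0" using t by (simp add: power2_eq_square algebra_simps)
    have q: "q > 0" "q\<^sup>2 = t - t\<^sup>2" using tt by (simp_all add: q_def)
    have "1 - (2 * t - 1)\<^sup>2 = (2 * q)\<^sup>2" unfolding power_mult_distrib q(2) by (simp add: power2_eq_square algebra_simps)
    then have sq: "sqrt (1 - (2 * t - 1)\<^sup>2) = 2 * q" using q(1) by (simp only: real_sqrt_abs)
    have D1: "((\<lambda>t. sqrt (t - t\<^sup>2)) has_real_derivative inverse q / 2 * (1 - 2 * t)) (at t)"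
      unfolding q_def by (rule DERIV_chain2[where f=sqrt and g="\<lambda>t. t - t\<^sup>2", OF DERIV_real_sqrt[OF tt]]) (auto intro!: derivative_eq_intros)
    have D2: "((\<lambda>t. arcsin (2 * t - 1)) has_real_derivative inverse (2 * q) * 2) (at t)"
      unfolding sq[symmetric] by (rule DERIV_chain2[where f=arcsin and g="\<lambda>t. 2 * t - 1", OF DERIV_arcsin]) (use t in \<open>auto intro!: derivative_eq_intros\<close>)
    have D3: "((\<lambda>t. (2 * t - 1) / 4) has_real_derivative 1/2) (at t)" by (auto intro!: derivative_eq_intros)
    have "(?F has_real_derivative (1 / sqrt 8) * ((1/2 * sqrt (t - t\<^sup>2) + (inverse q / 2 * (1 - 2 * t)) * ((2 * t - 1) / 4)) + (inverse (2 * q) * 2) / 8)) (at t)"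
      by (intro DERIV_cmult DERIV_add DERIV_mult D1 D3 DERIV_cdivide D2)
    also have "(1/2 * sqrt (t - t\<^sup>2) + (inverse q / 2 * (1 - 2 * t)) * ((2 * t - 1) / 4)) + (inverse (2 * q) * 2) / 8 = q"
    proof -
      have "(1/2 * q + (inverse q / 2 * (1 - 2 * t)) * ((2 * t - 1) / 4)) + (inverse (2 * q) * 2) / 8 = q / 2 + (4 * (t - t\<^sup>2)) / (8 * q)"
        using q(1) by (simp add: field_simps power2_eq_square)
      also have "\<dots> = q" unfolding q(2)[symmetric] using q(1) by (simp add: power2_eq_square)
      finally show ?thesis by (simp add: q_def)
    qed
    also have "(1 / sqrt 8) * q = sqrt (potential 4 1 t / 2)"
      using t by (simp add: q_def potential_def real_sqrt_divide[symmetric])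
    finally show "(?F has_vector_derivative sqrt (potential 4 1 t / 2)) (at t)"
      by (simp add: has_real_derivative_iff_has_vector_derivative)
  qed simp
  then have "unit_action 4 = ?F 1 - ?F 0" unfolding unit_action_def by (rule integral_unique)
  also have "\<dots> = pi / (8 * sqrt 8)" by (simp add: arcsin_minus_1)
  also have "sqrt 8 = 2 * sqrt 2" using real_sqrt_mult[of 4 2] by simp
  finally show ?thesis by simp
qed

text \<open>Dropping the defect bounds the energy of v below by a function of its peak n alone. The
  profile realizes the value of this function at its minimum m. Equality therefore forces n = m and
  zero defect.\<close>

lemma profile_energy_le:
  assumes p2: "2 < p" and p8: "p < 8" and M: "M\<^sub>0 > 0" and m: "m > 0" and v: "admissible v" "mass v = M\<^sub>0"
    and crit: "mass (profile.\<phi> p m) = M\<^sub>0"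
  shows "hamiltonian p (profile.\<phi> p m) \<le> hamiltonian p v"
    and "hamiltonian p v \<le> hamiltonian p (profile.\<phi> p m) \<Longrightarrow> \<exists>a. \<forall>x. (v x)\<^sup>2 = (profile.\<phi> p m (x - a))\<^sup>2"
proof -
  interpret profile p m using p2 m by unfold_locales
  let ?w = "\<lambda>x. (v x)\<^sup>2"
  interpret finite_energy ?w "weak_deriv ?w" by (rule admissible_finite_energy[OF v(1)])
  have "(LINT x|lborel. ?w x) > 0" using v M by (simp add: mass_eq)
  then obtain x0 where x0: "?w x0 > 0" "\<And>x. ?w x \<le> ?w x0" using w_attains_max by blast
  define n where "n = ?w x0"
  interpret b: bounded_energy ?w "weak_deriv ?w" p n x0
    using x0 p2 by unfold_locales (auto simp: n_def)
  let ?K = "unit_action p" and ?a = "1 + p/4" and ?b = "p/2 - 1"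
  have K: "?K > 0" by (rule unit_action_pos[OF p2])
  have Hv: "hamiltonian p v = (LINT x|lborel. b.defect x) + (2 * ?K * n powr ?a - n powr ?b / p * M\<^sub>0)"
    using b.energy_identity(2) v(2) by (simp add: hamiltonian_eq mass_eq)
  have H\<phi>: "hamiltonian p \<phi> = 2 * ?K * m powr ?a - m powr ?b / p * M\<^sub>0"
    using profile_hamiltonian[of \<phi> 0] crit by (simp add: \<phi>_cont)
  \<comment> \<open>This says that the derivative of 2 K n^a - n^b \<open>M\<^sub>0\<close> / p with
    respect to n vanishes at n = m.\<close>
  have stat: "?a * (2 * ?K * m powr ?a) = ?b * (m powr ?b / p * M\<^sub>0)"
    using mass_profile crit p by (simp add: c_def field_simps)
  \<comment> \<open>The common value of both sides of \<open>stat\<close>. Factoring it out turns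
    the function of n into that of \<open>powr_div_diff_min\<close> at y = n/m.\<close>
  define E where "E = ?a * (2 * ?K * m powr ?a)"
  have E: "E > 0" using K m p by (simp add: E_def)
  have e1: "2 * ?K * (m * y) powr ?a - (m * y) powr ?b / p * M\<^sub>0 = E * (y powr ?a / ?a - y powr ?b / ?b)" if "y > 0" for y
  proof -
    have "2 * ?K * (m * y) powr ?a = E * (y powr ?a / ?a)"
      using m that p by (simp add: E_def powr_mult)
    moreover have "(m * y) powr ?b / p * M\<^sub>0 = E * (y powr ?b / ?b)"
      unfolding E_def stat using m that p by (simp add: powr_mult)
    ultimately show ?thesis by (simp add: right_diff_distrib)
  qed
  have np: "n > 0" using x0(1) by (simp add: n_def)
  have strict: "hamiltonian p \<phi> < 2 * ?K * n powr ?a - n powr ?b / p * M\<^sub>0" if "n \<noteq> m"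
  proof -
    have "1 / ?a - 1 / ?b < (n/m) powr ?a / ?a - (n/m) powr ?b / ?b"
      by (rule powr_div_diff_min) (use p2 p8 np m that in auto)
    then have "E * (1 / ?a - 1 / ?b) < E * ((n/m) powr ?a / ?a - (n/m) powr ?b / ?b)"
      using E by (rule mult_strict_left_mono)
    then show ?thesis using e1[of 1] e1[of "n/m"] m np H\<phi> by simp
  qed
  show "hamiltonian p \<phi> \<le> hamiltonian p v"
    using strict b.defect_integral_nonneg H\<phi> Hv by (cases "n = m") auto
  assume le: "hamiltonian p v \<le> hamiltonian p \<phi>"
  have nm: "n = m" using strict le b.defect_integral_nonneg Hv by force
  have "(LINT x|lborel. b.defect x) = 0" using le b.defect_integral_nonneg Hv H\<phi> nm by simp
  then have "?w x = (\<phi> (x - x0))\<^sup>2" for x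
    using b.defect_0_imp_profile[of x] v(2) crit nm by (simp add: mass_eq)
  then show "\<exists>a. \<forall>x. (v x)\<^sup>2 = (\<phi> (x - a))\<^sup>2" by blast
qed

text \<open>The formula for m is \<open>mass_profile\<close> with mass \<open>M\<^sub>0\<close>,
  solved for m. Conversely, every continuous function whose square is a translate of W has the mass
  and energy of \<phi>, so all of them are minimizers.\<close>

lemma minimizer_iff_profile:
  assumes p2: "2 < p" and p8: "p < 8" and M: "M\<^sub>0 > 0"
    and m_def: "m = ((p - 2) * M\<^sub>0 / (p * (p + 4) * unit_action p)) powr (4 / (8 - p))"
  shows "is_minimizer p M\<^sub>0 u \<longleftrightarrow> translate_up_to_sign u (profile.\<phi> p m)"
proof -
  have K: "unit_action p > 0" by (rule unit_action_pos[OF p2])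
  define B where "B = (p - 2) * M\<^sub>0 / (p * (p + 4) * unit_action p)"
  have B: "B > 0" using p2 M K by (simp add: B_def)
  have m: "m > 0" using B by (simp add: m_def B_def[symmetric])
  interpret profile p m using p2 m by unfold_locales
  \<comment> \<open>The exponent 2 - p/4 is the difference of 1 + p/4 and p/2 - 1, the two powers of
    m in \<open>mass_profile\<close>; 4/(8 - p) is its reciprocal.\<close>
  have "m powr (2 - p/4) = B powr (4 / (8 - p) * (2 - p/4))" by (simp add: m_def B_def powr_powr)
  also have "4 / (8 - p) * (2 - p/4) = 1" using p8 by (simp add: divide_simps)
  finally have mB: "m powr (2 - p/4) = B" using B by simp
  have "m powr (1 + p/4) = m powr (2 - p/4) * m powr (p/2 - 1)"
    by (simp add: powr_add[symmetric] add.commute)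
  then have "2 * (p + 4) * unit_action p * m powr (1 + p/4) = 2 * ((p + 4) * unit_action p * B) * m powr (p/2 - 1)"
    by (simp add: mB)
  also have "(p + 4) * unit_action p * B = (p - 2) * M\<^sub>0 / p" using p2 K by (simp add: B_def)
  finally have "2 * (p + 4) * unit_action p * m powr (1 + p/4) = (p - 2) * c * M\<^sub>0" by (simp add: c_def)
  then have "(p - 2) * c * mass \<phi> = (p - 2) * c * M\<^sub>0" using mass_profile by simp
  then have mass\<phi>: "mass \<phi> = M\<^sub>0" using p c_pos by simp
  have prof: "admissible v \<and> mass v = M\<^sub>0 \<and> hamiltonian p v = hamiltonian p \<phi>"
    if v: "continuous_on UNIV v" "\<And>x. (v x)\<^sup>2 = W (x - a)" for v a
  proof -
    have "mass v = mass \<phi>"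
      using lborel_integral_real_affine[of 1 W "- a"] by (simp add: mass_eq v)
    moreover have "hamiltonian p v = hamiltonian p \<phi>"
      using profile_hamiltonian[OF v] profile_hamiltonian[of \<phi> 0] calculation by (simp add: \<phi>_cont)
    ultimately show ?thesis using profile_admissible[OF v] mass\<phi> by simp
  qed
  have \<phi>: "admissible \<phi>" using prof[of \<phi> 0] by (simp add: \<phi>_cont)
  show ?thesis unfolding translate_up_to_sign_iff
  proof
    assume u: "is_minimizer p M\<^sub>0 u"
    then have "hamiltonian p u \<le> hamiltonian p \<phi>" using \<phi> mass\<phi> by (simp add: is_minimizer_def)
    then show "continuous_on UNIV u \<and> (\<exists>a. \<forall>x. (u x)\<^sup>2 = W (x - a))"
      using profile_energy_le(2)[OF p2 p8 M m _ _ mass\<phi>, of u] u by (auto simp: is_minimizer_def admissible_def)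
  next
    assume "continuous_on UNIV u \<and> (\<exists>a. \<forall>x. (u x)\<^sup>2 = W (x - a))"
    then show "is_minimizer p M\<^sub>0 u"
      using prof[of u] profile_energy_le(1)[OF p2 p8 M m _ _ mass\<phi>] by (auto simp: is_minimizer_def)
  qed
qed

theorem theorem1p2:
  fixes p M\<^sub>0 :: real
  assumes "2 < p" and "p < 8" and "M\<^sub>0 > 0"
  shows "(\<exists>u. is_minimizer p M\<^sub>0 u) \<and>
         (\<forall>u. is_minimizer p M\<^sub>0 u \<longrightarrow>
            (\<exists>B c. compacton_params B c \<and> translate_up_to_sign u (compacton p B c))) \<and>
         (p = 4 \<longrightarrow>
            (\<forall>u. is_minimizer p M\<^sub>0 u \<longleftrightarrow>
               translate_up_to_sign u (compacton 4 0 (M\<^sub>0 / (sqrt 2 * pi)))))"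
proof -
  define m where "m = ((p - 2) * M\<^sub>0 / (p * (p + 4) * unit_action p)) powr (4 / (8 - p))"
  have m: "m > 0" using assms unit_action_pos[of p] by (simp add: m_def)
  interpret profile p m using assms m by unfold_locales
  note iff = minimizer_iff_profile[OF assms m_def]
  have "translate_up_to_sign \<phi> \<phi>" unfolding translate_up_to_sign_def by (rule exI[of _ 0]) simp
  then have "\<exists>u. is_minimizer p M\<^sub>0 u" using iff by blast
  \<comment> \<open>The parameter B = 0 serves for every p in the range.\<close>
  moreover have "compacton_params 0 c" using c_pos by (simp add: compacton_params_def)
  \<comment> \<open>For p = 4 the peak is m = sqrt 2 \<open>M\<^sub>0\<close> / pi, and c is
    m/2.\<close>
  moreover have "c = M\<^sub>0 / (sqrt 2 * pi)" if "p = 4"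
  proof -
    show ?thesis
      unfolding c_def unfolding m_def that unit_action_4
      using assms(3) by (simp add: field_simps)
  qed
  ultimately show ?thesis using iff compacton_eq by metis
qed

end
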